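(* Let $f$ satisfy (f1) and suppose $f_0\in(0,+\infty)$ and $f_\infty=0$. Then for every $\lambda\in(\lambda_1/f_0,+\infty)$, problem (MO) has two solutions $u^+$ and $u^-$ such that $u^+$ is positive and strictly concave in $(0,1)$ and $u^-$ is negative and strictly convex in $(0,1)$.
   Context: Let $N\ge 1$ be an integer and $f:\mathbb{R}\to\mathbb{R}$ continuous. For $\lambda\ge 0$, problem (MO) is: find $u\in C^2[0,1]$ with $\left((u'(r))^N\right)'=\lambda^N N r^{N-1} f(-u(r))$ for $0<r<1$ and $u'(0)=u(1)=0$. Condition (f1): $f\in C(\mathbb{R},\mathbb{R})$ and $f(s)s^N>0$ for all $s\neq0$. The quantities $f_0,f_\infty\in[0,+\infty]$ are defined by $f_0^N=\lim_{s\to0} f(s)/s^N$ and $f_\infty^N=\lim_{|s|\to+\infty} f(s)/s^N$ (limits assumed to exist in $[0,+\infty]$). $\lambda_1>0$ denotes the first eigenvalue of $\left((-v')^N\right)'=\lambda^N N r^{N-1}v^N$ in $(0,1)$, $v'(0)=v(1)=0$, i.e. the unique $\lambda>0$ for which this problem has a solution $v\in C^2[0,1]$ positive in $(0,1)$. *)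

theory Defs
  imports "HOL-Analysis.Analysis"
begin

definition strictly_convex_on :: "real set \<Rightarrow> (real \<Rightarrow> real) \<Rightarrow> bool" where
  "strictly_convex_on S g \<longleftrightarrow> convex S \<and>
     (\<forall>x\<in>S. \<forall>y\<in>S. x \<noteq> y \<longrightarrow> (\<forall>t. 0 < t \<and> t < 1 \<longrightarrow>
        g ((1 - t) * x + t * y) < (1 - t) * g x + t * g y))"

definition strictly_concave_on :: "real set \<Rightarrow> (real \<Rightarrow> real) \<Rightarrow> bool" where
  "strictly_concave_on S g \<longleftrightarrow> strictly_convex_on S (\<lambda>x. - g x)"

definition C2_on01 :: "(real \<Rightarrow> real) \<Rightarrow> (real \<Rightarrow> real) \<Rightarrow> (real \<Rightarrow> real) \<Rightarrow> bool" where
  "C2_on01 u u1 u2 \<longleftrightarrow>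
     (\<forall>r\<in>{0..1}. (u has_real_derivative u1 r) (at r within {0..1})) \<and>
     (\<forall>r\<in>{0..1}. (u1 has_real_derivative u2 r) (at r within {0..1})) \<and>
     continuous_on {0..1} u2"

definition MO_solution :: "nat \<Rightarrow> (real \<Rightarrow> real) \<Rightarrow> real \<Rightarrow> (real \<Rightarrow> real) \<Rightarrow> bool" where
  "MO_solution N f lam u \<longleftrightarrow>
     (\<exists>u1 u2. C2_on01 u u1 u2 \<and>
        (\<forall>r\<in>{0<..<1}. ((\<lambda>s. (u1 s) ^ N) has_real_derivative
             lam ^ N * real N * r ^ (N - 1) * f (- u r)) (at r)) \<and>
        u1 0 = 0 \<and> u 1 = 0)"

definition eig_solution :: "nat \<Rightarrow> real \<Rightarrow> (real \<Rightarrow> real) \<Rightarrow> bool" where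
  "eig_solution N lam v \<longleftrightarrow>
     (\<exists>v1 v2. C2_on01 v v1 v2 \<and>
        (\<forall>r\<in>{0<..<1}. ((\<lambda>s. (- v1 s) ^ N) has_real_derivative
             lam ^ N * real N * r ^ (N - 1) * (v r) ^ N) (at r)) \<and>
        v1 0 = 0 \<and> v 1 = 0)"

definition lambda1 :: "nat \<Rightarrow> real" where
  "lambda1 N = (THE lam. 0 < lam \<and>
      (\<exists>v. eig_solution N lam v \<and> (\<forall>r\<in>{0<..<1}. 0 < v r)))"

end

theory Submission
  imports Defs "HOL-Complex_Analysis.Great_Picard"
begin

text \<open>
  Both solutions come from one positive problem: with \<open>w = u\<close>, \<open>g s = (-1)^N f (-s)\<close> for \<open>u\<^sup>+\<close>, and
  \<open>w = -u\<close>, \<open>g = f\<close> for \<open>u\<^sup>-\<close>, (MO) reads \<open>((-w')^N)' = \<lambda>^N N r^(N-1) g(w)\<close>. Integrating and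
  rescaling gives \<open>w'(t) = - t root N (\<lambda>^N A(t))\<close>, where \<open>A(t)\<close> is the mean of \<open>x \<mapsto> g(w(t x))\<close> over
  \<open>[0,1]\<close> with weight \<open>N x^(N-1)\<close>; in this form the equation is regular at the origin.

  We shoot with the parameter \<open>w(0)\<close>. As \<open>g\<close> is only continuous, initial values need not determine
  solutions, so the intermediate value theorem is applied to Tonelli's delayed approximations, which
  depend continuously on the parameter, and the limit is taken with Arzela-Ascoli. For large
  \<open>w(0)\<close> the sublinearity at infinity keeps \<open>w\<close> positive up to \<open>1\<close>. For small \<open>w(0)\<close> the solution must
  vanish before \<open>1\<close>: otherwise \<open>w \<ge> k \<phi>\<close>, with \<open>\<phi>\<close> the first eigenfunction, would improve itself to
  \<open>w \<ge> q k \<phi>\<close> with a fixed \<open>q > 1\<close>. The same comparison shows that the positive eigenvalue is unique,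
  and shooting in the eigenvalue shows that it exists.
\<close>

section \<open>Weighted means over the unit interval and their N-th roots\<close>

definition wmean :: "nat \<Rightarrow> (real \<Rightarrow> real) \<Rightarrow> real" where
  "wmean N k = integral {0..1} (\<lambda>x. real N * x ^ (N - 1) * k x)"

text \<open>For continuous nonnegative \<open>k\<close>, \<open>t * rmean N k t\<close> is the N-th
  root of the integral of \<open>N s^(N-1) k(s)\<close> over \<open>[0,t]\<close>. Splitting off the
  factor \<open>t\<close> leaves a function that is continuous at 0, with value
  \<open>root N (k 0)\<close> there.\<close>

definition rmean :: "nat \<Rightarrow> (real \<Rightarrow> real) \<Rightarrow> real \<Rightarrow> real" where
  "rmean N k t = root N (wmean N (\<lambda>x. k (t * x)))"

lemma wmean_cong:
  assumes "\<And>x. x \<in> {0..1} \<Longrightarrow> k x = l x"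
  shows "wmean N k = wmean N l"
  unfolding wmean_def by (rule integral_cong) (simp add: assms)

lemma wmean_mono:
  assumes "continuous_on {0..1} k" "continuous_on {0..1} l"
    and "\<And>x. x \<in> {0..1} \<Longrightarrow> k x \<le> l x"
  shows "wmean N k \<le> wmean N l"
  unfolding wmean_def
  by (intro integral_le integrable_continuous_real continuous_intros assms mult_left_mono) auto

lemma wmean_cmult: "wmean N (\<lambda>x. c * k x) = c * wmean N k"
proof -
  have "(\<lambda>x. real N * x ^ (N - 1) * (c * k x)) = (\<lambda>x. c * (real N * x ^ (N - 1) * k x))"
    by (simp add: fun_eq_iff)
  then show ?thesis
    unfolding wmean_def by simp
qed

lemma wmean_const:
  assumes "N \<ge> 1"
  shows "wmean N (\<lambda>x. c) = c"
proof -
  have "((\<lambda>x. real N * x ^ (N - 1) * c) has_integral (1 ^ N * c - 0 ^ N * c)) {0..1}"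
    by (rule fundamental_theorem_of_calculus)
      (auto intro!: derivative_eq_intros simp flip: has_real_derivative_iff_has_vector_derivative)
  then show ?thesis
    using assms unfolding wmean_def by (subst integral_unique) (auto simp: zero_power)
qed

lemma wmean_nonneg:
  assumes "\<And>x. x \<in> {0..1} \<Longrightarrow> 0 \<le> k x"
  shows "0 \<le> wmean N k"
proof (cases "(\<lambda>x. real N * x ^ (N - 1) * k x) integrable_on {0..1}")
  case True
  then show ?thesis
    unfolding wmean_def by (intro integral_nonneg) (auto intro!: mult_nonneg_nonneg assms)
next
  \<comment> \<open>Here \<open>integral\<close> takes its default value 0.\<close>
  case False
  then show ?thesis
    by (simp add: wmean_def not_integrable_integral)
qed

text \<open>A vanishing integral of a continuous nonnegative function forces the integrand to
  vanish. For \<open>N > 1\<close> the weight is itself 0 at the origin, so \<open>k 0 = 0\<close>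
  is recovered by continuity from the open interval.\<close>

lemma wmean_pos:
  assumes "N \<ge> 1" and k: "continuous_on {0..1} k"
    and nn: "\<And>x. x \<in> {0..1} \<Longrightarrow> 0 \<le> k x" and k0: "k 0 > 0"
  shows "wmean N k > 0"
proof (rule ccontr)
  assume "\<not> wmean N k > 0"
  then have "wmean N k = 0"
    using wmean_nonneg[of k N] nn by force
  moreover have "integral {0..1} (\<lambda>x. real N * x ^ (N - 1) * k x) = 0
      \<longleftrightarrow> (\<forall>x\<in>{0..1}. real N * x ^ (N - 1) * k x = 0)"
    using k nn by (intro integral_eq_0_iff continuous_intros mult_nonneg_nonneg) auto
  ultimately have z: "\<forall>x\<in>{0..1}. real N * x ^ (N - 1) * k x = 0"
    by (simp add: wmean_def)
  have zk: "k x = 0" if "x \<in> {0<..<1}" for x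
  proof -
    have "x \<in> {0..1}"
      using that by auto
    with z have "real N * x ^ (N - 1) * k x = 0"
      by blast
    then show ?thesis
      using that \<open>N \<ge> 1\<close> by simp
  qed
  have "k 0 = 0"
    by (rule continuous_constant_on_closure[where S = "{0<..<1}" and f = k]) (use k zk in simp_all)
  then show False
    using k0 by simp
qed

lemma continuous_on_wmean:
  fixes k :: "'a::topological_space \<Rightarrow> real \<Rightarrow> real"
  assumes "continuous_on (U \<times> {0..1}) (\<lambda>(y, x). k y x)"
  shows "continuous_on U (\<lambda>y. wmean N (k y))"
proof -
  have "continuous_on (U \<times> cbox 0 1) (\<lambda>(y, x). real N * x ^ (N - 1) * k y x)"
    using assms unfolding case_prod_unfold by (auto intro!: continuous_intros)
  from integral_continuous_on_param[OF this] show ?thesis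
    by (simp add: wmean_def)
qed

text \<open>Substitute \<open>s = t x\<close>: the differential contributes one factor
  \<open>t\<close>, the weight the other \<open>N - 1\<close>.\<close>

lemma wmean_scale:
  assumes "N \<ge> 1" "0 \<le> t" and k: "continuous_on {0..t} k"
  shows "t ^ N * wmean N (\<lambda>x. k (t * x)) = integral {0..t} (\<lambda>s. real N * s ^ (N - 1) * k s)"
proof -
  have "((\<lambda>x. t *\<^sub>R (real N * (t * x) ^ (N - 1) * k (t * x))) has_integral
      integral {t * 0..t * 1} (\<lambda>s. real N * s ^ (N - 1) * k s)) {0..1}"
    by (rule has_integral_substitution[where c = 0 and d = t])
      (use assms in \<open>auto intro!: continuous_intros derivative_eq_intros mult_left_le\<close>)
  moreover have "(\<lambda>x. t *\<^sub>R (real N * (t * x) ^ (N - 1) * k (t * x)))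
      = (\<lambda>x. t ^ N * (real N * x ^ (N - 1) * k (t * x)))"
    using \<open>N \<ge> 1\<close> by (cases N) (auto simp: fun_eq_iff power_mult_distrib)
  ultimately have "integral {0..1} (\<lambda>x. t ^ N * (real N * x ^ (N - 1) * k (t * x)))
      = integral {0..t} (\<lambda>s. real N * s ^ (N - 1) * k s)"
    by (simp only: integral_unique mult_zero_right mult_1_right)
  then show ?thesis
    unfolding wmean_def by (simp only: integral_mult_right)
qed

lemma continuous_on_scaled:
  fixes k :: "real \<Rightarrow> real"
  assumes "continuous_on {0..1} k" "t \<in> {0..1}"
  shows "continuous_on {0..1} (\<lambda>x. k (t * x))"
  by (rule continuous_on_compose2[OF assms(1)])
    (use assms(2) in \<open>auto intro!: continuous_intros mult_le_one\<close>)

lemma scaled_in_unit: "t \<in> {0..1} \<Longrightarrow> x \<in> {0..1} \<Longrightarrow> t * x \<in> {0..1::real}"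
  by (auto intro: mult_le_one)

lemma continuous_on_rmean:
  assumes "continuous_on {0..1} k"
  shows "continuous_on {0..1} (rmean N k)"
  unfolding rmean_def
  by (intro continuous_intros continuous_on_wmean)
    (auto simp: case_prod_unfold intro!: continuous_on_compose2[OF assms] continuous_intros mult_le_one)

lemma rmean_cong:
  assumes "\<And>x. x \<in> {0..1} \<Longrightarrow> k x = l x" "t \<in> {0..1}"
  shows "rmean N k t = rmean N l t"
  unfolding rmean_def using assms scaled_in_unit by (auto intro!: arg_cong[where f = "root N"] wmean_cong)

lemma rmean_mono_scaled:
  assumes "N \<ge> 1" "continuous_on {0..1} k" "continuous_on {0..1} l" "t \<in> {0..1}" "s \<in> {0..1}"
    and "\<And>x. x \<in> {0..1} \<Longrightarrow> k (t * x) \<le> l (s * x)"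
  shows "rmean N k t \<le> rmean N l s"
  unfolding rmean_def using assms
  by (intro real_root_le_mono wmean_mono continuous_on_scaled) auto

lemma rmean_mono:
  assumes "N \<ge> 1" "continuous_on {0..1} k" "continuous_on {0..1} l" "t \<in> {0..1}"
    and "\<And>x. x \<in> {0..1} \<Longrightarrow> k x \<le> l x"
  shows "rmean N k t \<le> rmean N l t"
  using assms scaled_in_unit by (intro rmean_mono_scaled) auto

lemma rmean_nonneg:
  assumes "N \<ge> 1" "t \<in> {0..1}" "\<And>x. x \<in> {0..1} \<Longrightarrow> 0 \<le> k x"
  shows "0 \<le> rmean N k t"
  unfolding rmean_def using assms scaled_in_unit by (intro real_root_ge_zero wmean_nonneg) auto

lemma rmean_pos:
  assumes "N \<ge> 1" "continuous_on {0..1} k" "t \<in> {0..1}" "\<And>x. x \<in> {0..1} \<Longrightarrow> 0 \<le> k x" "0 < k 0"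
  shows "0 < rmean N k t"
  unfolding rmean_def using assms scaled_in_unit continuous_on_scaled
  by (intro real_root_gt_zero wmean_pos) auto

lemma rmean_const: "N \<ge> 1 \<Longrightarrow> rmean N (\<lambda>x. c) t = root N c"
  by (simp add: rmean_def wmean_const)

lemma rmean_0: "N \<ge> 1 \<Longrightarrow> rmean N k 0 = root N (k 0)"
  by (simp add: rmean_def wmean_const)

lemma rmean_cmult:
  assumes "N \<ge> 1" "0 \<le> c"
  shows "rmean N (\<lambda>x. c ^ N * k x) t = c * rmean N k t"
  using assms by (simp add: rmean_def wmean_cmult real_root_mult real_root_power_cancel)

lemma rmean_power:
  assumes "N \<ge> 1" "continuous_on {0..1} k" "t \<in> {0..1}" "\<And>x. x \<in> {0..1} \<Longrightarrow> 0 \<le> k x"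
  shows "(t * rmean N k t) ^ N = integral {0..t} (\<lambda>s. real N * s ^ (N - 1) * k s)"
proof -
  have "0 \<le> wmean N (\<lambda>x. k (t * x))"
    using assms scaled_in_unit by (intro wmean_nonneg) auto
  then have "rmean N k t ^ N = wmean N (\<lambda>x. k (t * x))"
    using assms(1) by (simp add: rmean_def)
  moreover have "continuous_on {0..t} k"
    using assms by (auto intro: continuous_on_subset)
  ultimately show ?thesis
    using wmean_scale[of N t k] assms by (simp add: power_mult_distrib)
qed

lemma rmean_power_has_derivative:
  assumes "N \<ge> 1" "continuous_on {0..1} k" "t \<in> {0..1}" "\<And>x. x \<in> {0..1} \<Longrightarrow> 0 \<le> k x"
  shows "((\<lambda>s. (s * rmean N k s) ^ N) has_real_derivative real N * t ^ (N - 1) * k t) (at t within {0..1})"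
proof -
  have "((\<lambda>s. integral {0..s} (\<lambda>s. real N * s ^ (N - 1) * k s)) has_real_derivative real N * t ^ (N - 1) * k t)
      (at t within {0..1})"
    by (rule integral_has_real_derivative) (auto intro!: continuous_intros assms simp: assms(3)[simplified])
  then show ?thesis
    by (rule has_field_derivative_transform_within[where d = 1]) (use assms rmean_power in auto)
qed

text \<open>This is the C2 regularity up to the centre. Positivity of \<open>k 0\<close> keeps the
  mean positive, so for \<open>t > 0\<close> the root is differentiated away from 0. At
  \<open>t = 0\<close> the chain rule fails, but the difference quotient is \<open>rmean N k\<close>
  itself, which is continuous.\<close>

lemma rmean_has_derivative:
  assumes N: "N \<ge> 1" and k: "continuous_on {0..1} k" and t: "t \<in> {0..1}"
    and nn: "\<And>x. x \<in> {0..1} \<Longrightarrow> 0 \<le> k x" and k0: "0 < k 0"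
  shows "((\<lambda>s. s * rmean N k s) has_real_derivative k t / rmean N k t ^ (N - 1)) (at t within {0..1})"
proof (cases "t = 0")
  case True
  have "(rmean N k \<longlongrightarrow> rmean N k 0) (at 0 within {0..1})"
    using continuous_on_rmean[OF k] by (auto simp: continuous_on)
  \<comment> \<open>The formula found for positive \<open>t\<close> has the right value at 0 too,
    since \<open>l = root N (k 0)\<close> satisfies \<open>l * l^(N-1) = k 0\<close>.\<close>
  moreover have "rmean N k 0 = k 0 / rmean N k 0 ^ (N - 1)"
  proof -
    have "root N (k 0) * root N (k 0) ^ (N - 1) = k 0"
      using N k0 real_root_pow_pos[of N "k 0"] by (cases N) auto
    then show ?thesis
      using N k0 by (simp add: rmean_0 field_simps)
  qed
  moreover have "((\<lambda>s. (s * rmean N k s - 0 * rmean N k 0) / (s - 0)) \<longlongrightarrow> L) (at 0 within {0..1})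
      \<longleftrightarrow> (rmean N k \<longlongrightarrow> L) (at 0 within {0..1})" for L
    by (rule tendsto_cong) (auto simp: eventually_at_filter)
  ultimately show ?thesis
    unfolding has_field_derivative_iff True by simp
next
  case False
  with t have tpos: "0 < t" by auto
  define F where "F s = (s * rmean N k s) ^ N" for s
  have rp: "0 < rmean N k s" if "s \<in> {0..1}" for s
    using rmean_pos[OF N k that nn k0] .
  have "0 < F t"
    unfolding F_def using tpos rp[OF t] by simp
  have root: "root N (F s) = s * rmean N k s" if "s \<in> {0..1}" for s
    unfolding F_def using N that rp[OF that] by (intro real_root_power_cancel) auto
  have "((\<lambda>s. root N (F s)) has_real_derivative
      inverse (real N * root N (F t) ^ (N - Suc 0)) * (real N * t ^ (N - 1) * k t)) (at t within {0..1})"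
    by (rule DERIV_chain2[OF DERIV_real_root])
      (use N \<open>0 < F t\<close> rmean_power_has_derivative[OF N k t nn] in \<open>auto simp: F_def[abs_def]\<close>)
  moreover have "inverse (real N * root N (F t) ^ (N - Suc 0)) * (real N * t ^ (N - 1) * k t)
      = k t / rmean N k t ^ (N - 1)"
    using N tpos rp[OF t] by (simp add: root[OF t] power_mult_distrib field_simps)
  ultimately have "((\<lambda>s. root N (F s)) has_real_derivative k t / rmean N k t ^ (N - 1)) (at t within {0..1})"
    by simp
  then show ?thesis
    by (rule has_field_derivative_transform_within[where d = 1]) (use t root in auto)
qed

lemma wmean_tendsto:
  assumes K: "\<And>n. continuous_on {0..1} (K n)"
    and bound: "\<And>n x. x \<in> {0..1} \<Longrightarrow> \<bar>K n x\<bar> \<le> M"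
    and lim: "\<And>x. x \<in> {0..1} \<Longrightarrow> (\<lambda>n. K n x) \<longlonglongrightarrow> k x"
  shows "(\<lambda>n. wmean N (K n)) \<longlonglongrightarrow> wmean N k"
  unfolding wmean_def
proof (rule dominated_convergence(2)[where h = "\<lambda>x. real N * x ^ (N - 1) * M"])
  show "(\<lambda>x. real N * x ^ (N - 1) * K n x) integrable_on {0..1}" for n
    by (intro integrable_continuous_real continuous_intros K)
  show "(\<lambda>x. real N * x ^ (N - 1) * M) integrable_on {0..1}"
    by (intro integrable_continuous_real continuous_intros)
  show "norm (real N * x ^ (N - 1) * K n x) \<le> real N * x ^ (N - 1) * M" if "x \<in> {0..1}" for n x
    using bound[OF that, of n] that by (simp add: abs_mult mult_left_mono)
  show "(\<lambda>n. real N * x ^ (N - 1) * K n x) \<longlonglongrightarrow> real N * x ^ (N - 1) * k x" if "x \<in> {0..1}" for x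
    by (intro tendsto_intros lim that)
qed

lemma rmean_tendsto:
  assumes "\<And>n. continuous_on {0..1} (K n)" and "\<And>n x. x \<in> {0..1} \<Longrightarrow> \<bar>K n x\<bar> \<le> M"
    and "\<And>x. x \<in> {0..1} \<Longrightarrow> (\<lambda>n. K n x) \<longlonglongrightarrow> k x" and "t \<in> {0..1}"
  shows "(\<lambda>n. rmean N (K n) t) \<longlonglongrightarrow> rmean N k t"
  unfolding rmean_def
  by (intro tendsto_real_root wmean_tendsto[where M = M] continuous_on_scaled assms scaled_in_unit)

section \<open>Shooting with Tonelli's delayed approximations\<close>

text \<open>\<open>p\<close> is the shooting parameter and \<open>d p\<close> the value at the
  centre. Letting both \<open>H\<close> and \<open>d\<close> depend on \<open>p\<close> covers
  shooting in the initial value (\<open>d\<close> the identity) and in the eigenvalue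
  (\<open>d\<close> constant). The bound \<open>M\<close> on \<open>H\<close> yields a Lipschitz
  constant uniform in \<open>p\<close>.\<close>

locale shooting =
  fixes N :: nat and H :: "real \<Rightarrow> real \<Rightarrow> real" and d :: "real \<Rightarrow> real" and a b M :: real
  assumes N: "N \<ge> 1" and ab: "a \<le> b"
    and H_cont: "continuous_on UNIV (\<lambda>(p, s). H p s)"
    and H_nonneg: "\<And>p s. p \<in> {a..b} \<Longrightarrow> 0 \<le> H p s"
    and H_le: "\<And>p s. p \<in> {a..b} \<Longrightarrow> H p s \<le> M"
    and d_cont: "continuous_on UNIV d"
begin

definition ivp_solution :: "real \<Rightarrow> (real \<Rightarrow> real) \<Rightarrow> bool" where
  "ivp_solution p w \<longleftrightarrow> continuous_on {0..1} w \<and>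
     (\<forall>r\<in>{0..1}. w r = d p - integral {0..r} (\<lambda>t. t * rmean N (\<lambda>s. H p (w s)) t))"

text \<open>\<open>1 / real (Suc n)\<close> is the delay and \<open>k\<close> counts iterations. The
  integral over \<open>[0,r]\<close> is written as \<open>r\<close> times a mean with weight 1
  (\<open>wmean 1\<close>), so that its domain is fixed and joint continuity in \<open>p\<close> and
  \<open>r\<close> follows from \<open>continuous_on_wmean\<close>.\<close>

primrec tonelli :: "nat \<Rightarrow> nat \<Rightarrow> real \<Rightarrow> real \<Rightarrow> real" where
  "tonelli n 0 p r = d p"
| "tonelli n (Suc k) p r = d p - r * wmean 1 (\<lambda>y. r * y *
     rmean N (\<lambda>s. H p (tonelli n k p (max 0 (s - 1 / real (Suc n))))) (r * y))"

text \<open>\<open>Suc n\<close> steps of length \<open>1 / real (Suc n)\<close> cover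
  \<open>[0,1]\<close>, so this many iterations reach the fixed point of the delayed
  equation.\<close>

definition approx :: "nat \<Rightarrow> real \<Rightarrow> real \<Rightarrow> real" where
  "approx n p r = tonelli n (Suc n) p r"

lemma continuous_on_H:
  assumes "continuous_on S f" "continuous_on S g"
  shows "continuous_on S (\<lambda>z. H (f z) (g z))"
  using continuous_on_compose2[OF H_cont continuous_on_Pair[OF assms]] by simp

lemma continuous_on_d: "continuous_on S f \<Longrightarrow> continuous_on S (\<lambda>z. d (f z))"
  by (rule continuous_on_compose2[OF d_cont]) auto

lemma continuous_on_tonelli_pair: "continuous_on UNIV (\<lambda>z. tonelli n k (fst z) (snd z))"
proof (induction k)
  case 0
  then show ?case
    by (simp add: continuous_on_d continuous_on_fst)
next
  case (Suc k)
  \<comment> \<open>The type is that of \<open>(((p, r), y), x)\<close>, the tuple present once both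
    means have been opened.\<close>
  have T: "continuous_on S (\<lambda>z. tonelli n k (f z) (g z))"
    if "continuous_on S f" "continuous_on S g"
    for S and f g :: "((real \<times> real) \<times> real) \<times> real \<Rightarrow> real"
    using continuous_on_compose2[OF Suc continuous_on_Pair[OF that]] by simp
  show ?case
    unfolding tonelli.simps rmean_def
    by (intro continuous_intros continuous_on_d continuous_on_wmean, unfold case_prod_unfold)
      (intro continuous_intros continuous_on_wmean, unfold case_prod_unfold,
        intro continuous_intros continuous_on_H T)
qed

lemma continuous_on_approx:
  assumes "continuous_on S f" "continuous_on S g"
  shows "continuous_on S (\<lambda>z. approx n (f z) (g z))"
  using continuous_on_compose2[OF continuous_on_tonelli_pair continuous_on_Pair[OF assms], of n "Suc n"]
  by (simp add: approx_def del: tonelli.simps)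

lemma continuous_on_delayed: "continuous_on S (\<lambda>s. H p (approx n p (max 0 (s - 1 / real (Suc n)))))"
  by (intro continuous_on_H continuous_on_approx continuous_intros)

text \<open>The value at \<open>r\<close> sees the previous iterate only up to \<open>r\<close>
  minus the delay, cut off at 0. Each iteration therefore extends the interval on which nothing
  changes any more by one delay.\<close>

lemma tonelli_stationary:
  assumes "0 \<le> r" "r \<le> real k / real (Suc n)"
  shows "tonelli n (Suc k) p r = tonelli n k p r"
  using assms
proof (induction k arbitrary: r)
  case 0
  then show ?case
    by simp
next
  case (Suc k)
  have eq: "tonelli n (Suc k) p (max 0 (r * y * x - 1 / real (Suc n)))
      = tonelli n k p (max 0 (r * y * x - 1 / real (Suc n)))"
    if "x \<in> {0..1}" "y \<in> {0..1}" for x y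
  proof (rule Suc.IH)
    have "r * (y * x) \<le> r * 1"
      using that Suc.prems by (intro mult_left_mono mult_le_one) auto
    also have "\<dots> \<le> real (Suc k) / real (Suc n)"
      using Suc.prems by simp
    also have "\<dots> = real k / real (Suc n) + 1 / real (Suc n)"
      by (simp add: field_simps)
    finally show "max 0 (r * y * x - 1 / real (Suc n)) \<le> real k / real (Suc n)"
      by (auto simp: mult.assoc)
  qed auto
  show ?case
    unfolding tonelli.simps(2)[of n "Suc k"] tonelli.simps(2)[of n k p r] rmean_def
    by (intro arg_cong2[where f = minus] arg_cong2[where f = times] arg_cong[where f = "root N"]
        wmean_cong arg_cong[where f = "H p"] eq refl)
qed

lemma approx_eq:
  assumes "r \<in> {0..1}"
  shows "approx n p r = d p - integral {0..r}
    (\<lambda>t. t * rmean N (\<lambda>s. H p (approx n p (max 0 (s - 1 / real (Suc n))))) t)"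
proof -
  let ?k = "\<lambda>t. t * rmean N (\<lambda>s. H p (approx n p (max 0 (s - 1 / real (Suc n))))) t"
  have "approx n p r = tonelli n (Suc (Suc n)) p r"
    unfolding approx_def using assms by (intro tonelli_stationary[symmetric]) auto
  \<comment> \<open>The exponent 1 is written out to match \<open>wmean_scale\<close> for weight
    1.\<close>
  also have "\<dots> = d p - r ^ 1 * wmean 1 (\<lambda>y. ?k (r * y))"
    by (simp only: tonelli.simps(2)[of n "Suc n"] approx_def power_one_right)
  also have "r ^ 1 * wmean 1 (\<lambda>y. ?k (r * y)) = integral {0..r} ?k"
    using assms
    by (subst wmean_scale) (auto simp del: of_nat_Suc
        intro!: continuous_intros continuous_on_subset[OF continuous_on_rmean[OF continuous_on_delayed]])
  finally show ?thesis .
qed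

lemma rmean_bounds:
  assumes "p \<in> {a..b}" "t \<in> {0..1}" "continuous_on {0..1} (\<lambda>s. H p (w s))"
  shows "0 \<le> rmean N (\<lambda>s. H p (w s)) t" "rmean N (\<lambda>s. H p (w s)) t \<le> root N M"
proof -
  show "0 \<le> rmean N (\<lambda>s. H p (w s)) t"
    using assms N H_nonneg by (intro rmean_nonneg) auto
  have "rmean N (\<lambda>s. H p (w s)) t \<le> rmean N (\<lambda>s. M) t"
    using assms N H_le by (intro rmean_mono) auto
  then show "rmean N (\<lambda>s. H p (w s)) t \<le> root N M"
    using N by (simp add: rmean_const)
qed

lemma M_nonneg: "0 \<le> M"
  using H_nonneg[of a 0] H_le[of a 0] ab by auto

lemma approx_has_derivative:
  assumes "r \<in> {0..1}"
  shows "(approx n p has_real_derivative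
    - (r * rmean N (\<lambda>s. H p (approx n p (max 0 (s - 1 / real (Suc n))))) r)) (at r within {0..1})"
proof -
  let ?k = "\<lambda>t. t * rmean N (\<lambda>s. H p (approx n p (max 0 (s - 1 / real (Suc n))))) t"
  have "((\<lambda>r. integral {0..r} ?k) has_real_derivative ?k r) (at r within {0..1})"
    using assms by (intro integral_has_real_derivative continuous_intros continuous_on_rmean continuous_on_delayed)
  then have "((\<lambda>r. d p - integral {0..r} ?k) has_real_derivative - ?k r) (at r within {0..1})"
    by (auto intro!: derivative_eq_intros)
  then show ?thesis
    by (rule has_field_derivative_transform_within[where d = 1]) (use assms approx_eq in auto)
qed

text \<open>The mean is at most \<open>root N M\<close> and \<open>r\<close> at most 1. The constant
  depends on neither \<open>n\<close> nor \<open>p\<close>, which gives the equicontinuity for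
  Arzela-Ascoli.\<close>

lemma approx_lipschitz:
  assumes p: "p \<in> {a..b}" and rs: "r \<in> {0..1}" "s \<in> {0..1}"
  shows "\<bar>approx n p r - approx n p s\<bar> \<le> root N M * \<bar>r - s\<bar>"
proof -
  have "norm (approx n p r - approx n p s) \<le> root N M * norm (r - s)"
  proof (rule field_differentiable_bound[OF _ approx_has_derivative])
    fix z :: real assume z: "z \<in> {0..1}"
    let ?r = "rmean N (\<lambda>s. H p (approx n p (max 0 (s - 1 / real (Suc n))))) z"
    have "0 \<le> ?r" "?r \<le> root N M"
      using rmean_bounds[OF p z continuous_on_delayed] by auto
    with z have "z * ?r \<le> 1 * root N M"
      by (intro mult_mono) auto
    then show "norm (- (z * ?r)) \<le> root N M"
      using z \<open>0 \<le> ?r\<close> by (simp add: abs_mult)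
  qed (use rs in auto)
  then show ?thesis
    by simp
qed

text \<open>The parameter may vary with \<open>n\<close>: compactness of \<open>[a,b]\<close> makes
  it converge along a subsequence, Arzela-Ascoli then extracts a uniform limit, and dominated
  convergence carries the delayed integral equation to the undelayed one.\<close>

lemma approx_limit:
  assumes q: "\<And>n. q n \<in> {a..b}"
  obtains p w \<sigma> where "p \<in> {a..b}" "strict_mono \<sigma>" "(q \<circ> \<sigma>) \<longlonglongrightarrow> p" "ivp_solution p w"
    "(\<lambda>n. approx (\<sigma> n) (q (\<sigma> n)) 1) \<longlonglongrightarrow> w 1"
proof -
  obtain p \<sigma>1 where p: "p \<in> {a..b}" and s1: "strict_mono \<sigma>1" and q1: "(q \<circ> \<sigma>1) \<longlonglongrightarrow> p"
    using compact_imp_seq_compact[OF compact_Icc[of a b]] q unfolding seq_compact_def by metis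
  have "bounded (d ` {a..b})"
    by (intro compact_imp_bounded compact_continuous_image continuous_on_subset[OF d_cont]) auto
  then obtain D where D: "\<And>p. p \<in> {a..b} \<Longrightarrow> \<bar>d p\<bar> \<le> D"
    unfolding bounded_iff by force
  have a0: "approx n p 0 = d p" for n p
    using approx_eq[of 0 n p] by simp
  have K0: "0 \<le> root N M"
    using M_nonneg N by simp
  define F where "F n = approx (\<sigma>1 n) (q (\<sigma>1 n))" for n
  have Flip: "\<bar>F n r - F n s\<bar> \<le> root N M * \<bar>r - s\<bar>" if "r \<in> {0..1}" "s \<in> {0..1}" for n r s
    unfolding F_def by (intro approx_lipschitz q that)
  have Fbd: "norm (F n x) \<le> D + root N M" if x: "x \<in> {0..1}" for n x
  proof -
    have "\<bar>F n x - F n 0\<bar> \<le> root N M * \<bar>x - 0\<bar>"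
      using x by (intro Flip) auto
    also have "\<dots> \<le> root N M * 1"
      using x K0 by (intro mult_left_mono) auto
    finally show ?thesis
      using D[OF q, of "\<sigma>1 n"] by (simp add: F_def a0)
  qed
  have Feq: "\<exists>\<delta>>0. \<forall>n y. y \<in> {0..1} \<and> norm (x - y) < \<delta> \<longrightarrow> norm (F n x - F n y) < e"
    if "x \<in> {0..1}" "0 < e" for x e
  \<comment> \<open>Adding 1 keeps the denominator positive when \<open>M = 0\<close>.\<close>
  proof (intro exI[of _ "e / (root N M + 1)"] conjI allI impI)
    show "0 < e / (root N M + 1)"
      using K0 \<open>0 < e\<close> by simp
    fix n y assume y: "y \<in> {0..1} \<and> norm (x - y) < e / (root N M + 1)"
    have "norm (F n x - F n y) \<le> root N M * \<bar>x - y\<bar>"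
      using Flip that y by auto
    also have "\<dots> \<le> (root N M + 1) * \<bar>x - y\<bar>"
      by (simp add: algebra_simps)
    also have "\<dots> < e"
      using y K0 by (simp add: field_simps)
    finally show "norm (F n x - F n y) < e" .
  qed
  obtain w \<sigma>2 where w: "continuous_on {0..1} w" and s2: "strict_mono (\<sigma>2 :: nat \<Rightarrow> nat)"
    and conv: "\<And>e. 0 < e \<Longrightarrow> \<exists>N. \<forall>n x. n \<ge> N \<and> x \<in> {0..1} \<longrightarrow> norm (F (\<sigma>2 n) x - w x) < e"
    using Arzela_Ascoli[of "{0..1::real}" F "D + root N M", OF compact_Icc Fbd Feq] by blast
  define \<sigma> where "\<sigma> = \<sigma>1 \<circ> \<sigma>2"
  have sm: "strict_mono \<sigma>"
    unfolding \<sigma>_def using s1 s2 by (rule strict_mono_o)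
  have qs: "(q \<circ> \<sigma>) \<longlonglongrightarrow> p"
    unfolding \<sigma>_def comp_assoc[symmetric] by (rule LIMSEQ_subseq_LIMSEQ[OF q1 s2])
  define G where "G n = approx (\<sigma> n) (q (\<sigma> n))" for n
  have FG: "F (\<sigma>2 n) = G n" for n
    by (simp add: F_def G_def \<sigma>_def)
  have Glim: "(\<lambda>n. G n x) \<longlonglongrightarrow> w x" if "x \<in> {0..1}" for x
    unfolding lim_sequentially dist_norm using conv that FG by metis
  define \<tau> where "\<tau> n s = max 0 (s - 1 / real (Suc (\<sigma> n)))" for n s
  \<comment> \<open>The delay disappears in the limit: by the Lipschitz bound it changes the value
    by at most \<open>root N M\<close> times its length.\<close>
  have delay: "(\<lambda>n. G n (\<tau> n s)) \<longlonglongrightarrow> w s" if s: "s \<in> {0..1}" for s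
  proof -
    have "(\<lambda>n. 1 / real (Suc n)) \<longlonglongrightarrow> 0"
      by (rule LIMSEQ_inverse_real_of_nat[unfolded inverse_eq_divide])
    from LIMSEQ_subseq_LIMSEQ[OF this sm] have "(\<lambda>n. root N M * (1 / real (Suc (\<sigma> n)))) \<longlonglongrightarrow> 0"
      by (intro tendsto_mult_right_zero) (simp add: comp_def)
    then have "(\<lambda>n. G n (\<tau> n s) - G n s) \<longlonglongrightarrow> 0"
    proof (rule Lim_null_comparison[rotated], intro always_eventually allI)
      fix n
      have "\<tau> n s \<in> {0..1}"
        using s by (auto simp: \<tau>_def intro: order_trans[of _ s])
      then have "\<bar>G n (\<tau> n s) - G n s\<bar> \<le> root N M * \<bar>\<tau> n s - s\<bar>"
        unfolding G_def by (intro approx_lipschitz q s)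
      also have "\<dots> \<le> root N M * (1 / real (Suc (\<sigma> n)))"
        using s K0 by (intro mult_left_mono) (auto simp: \<tau>_def max_def)
      finally show "norm (G n (\<tau> n s) - G n s) \<le> root N M * (1 / real (Suc (\<sigma> n)))"
        by simp
    qed
    from tendsto_add[OF this Glim[OF s]] show ?thesis
      by simp
  qed
  have Hlim: "(\<lambda>n. H (q (\<sigma> n)) (G n (\<tau> n s))) \<longlonglongrightarrow> H p (w s)" if "s \<in> {0..1}" for s
  proof -
    have "isCont (\<lambda>(p, s). H p s) (p, w s)"
      using H_cont by (simp add: continuous_on_eq_continuous_at)
    from isCont_tendsto_compose[OF this tendsto_Pair[OF qs delay[OF that]]] show ?thesis
      by simp
  qed
  have Hc: "continuous_on {0..1} (\<lambda>s. H (q (\<sigma> n)) (G n (\<tau> n s)))" for n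
    unfolding G_def \<tau>_def by (rule continuous_on_delayed)
  have "w r = d p - integral {0..r} (\<lambda>t. t * rmean N (\<lambda>s. H p (w s)) t)" if r: "r \<in> {0..1}" for r
  proof (rule LIMSEQ_unique[OF Glim[OF r]])
    have "(\<lambda>n. integral {0..r} (\<lambda>t. t * rmean N (\<lambda>s. H (q (\<sigma> n)) (G n (\<tau> n s))) t))
        \<longlonglongrightarrow> integral {0..r} (\<lambda>t. t * rmean N (\<lambda>s. H p (w s)) t)"
    proof (rule dominated_convergence(2)[where h = "\<lambda>t. root N M"])
      fix n t assume t: "t \<in> {0..r}"
      then have t1: "t \<in> {0..1}"
        using r by auto
      let ?r = "rmean N (\<lambda>s. H (q (\<sigma> n)) (G n (\<tau> n s))) t"
      have "0 \<le> ?r" "?r \<le> root N M"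
        using rmean_bounds[OF q t1 Hc] by auto
      with t1 have "t * ?r \<le> 1 * root N M"
        by (intro mult_mono) auto
      then show "norm (t * ?r) \<le> root N M"
        using t1 \<open>0 \<le> ?r\<close> by (simp add: abs_mult)
    next
      fix t assume "t \<in> {0..r}"
      then have t1: "t \<in> {0..1}"
        using r by auto
      show "(\<lambda>n. t * rmean N (\<lambda>s. H (q (\<sigma> n)) (G n (\<tau> n s))) t) \<longlonglongrightarrow> t * rmean N (\<lambda>s. H p (w s)) t"
        using H_nonneg[OF q] H_le[OF q]
        by (intro tendsto_intros rmean_tendsto[where M = M] Hc Hlim t1) auto
    next
      fix n
      show "(\<lambda>t. t * rmean N (\<lambda>s. H (q (\<sigma> n)) (G n (\<tau> n s))) t) integrable_on {0..r}"
        using r by (intro integrable_continuous_real continuous_intros continuous_on_subset[OF continuous_on_rmean[OF Hc]]) auto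
    qed auto
    moreover have "(\<lambda>n. d (q (\<sigma> n))) \<longlonglongrightarrow> d p"
      using d_cont qs by (auto simp: continuous_on_eq_continuous_at comp_def intro: isCont_tendsto_compose)
    ultimately have "(\<lambda>n. d (q (\<sigma> n)) - integral {0..r} (\<lambda>t. t * rmean N (\<lambda>s. H (q (\<sigma> n)) (G n (\<tau> n s))) t))
        \<longlonglongrightarrow> d p - integral {0..r} (\<lambda>t. t * rmean N (\<lambda>s. H p (w s)) t)"
      by (intro tendsto_intros)
    then show "(\<lambda>n. G n r) \<longlonglongrightarrow> d p - integral {0..r} (\<lambda>t. t * rmean N (\<lambda>s. H p (w s)) t)"
      unfolding G_def \<tau>_def by (simp only: approx_eq[OF r, symmetric])
  qed
  then have "ivp_solution p w"
    using w by (simp add: ivp_solution_def)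
  moreover have "(\<lambda>n. approx (\<sigma> n) (q (\<sigma> n)) 1) \<longlonglongrightarrow> w 1"
    using Glim[of 1] by (simp add: G_def)
  ultimately show thesis
    using that p sm qs by blast
qed

text \<open>Every alternative in the conclusion of the intermediate value theorem below is a closed
  condition on \<open>(p, w 1)\<close>, so a single limit passage covers the interior and both end points.\<close>

lemma shooting_root:
  assumes left: "\<And>w. ivp_solution a w \<Longrightarrow> w 1 < 0" and right: "\<And>w. ivp_solution b w \<Longrightarrow> w 1 > 0"
  obtains p w where "p \<in> {a..b}" "ivp_solution p w" "w 1 = 0"
proof -
  define C where "C = (UNIV \<times> {0}) \<union> ({a} \<times> {0..}) \<union> ({b} \<times> {..0::real})"
  have "closed C"
    unfolding C_def by (intro closed_Un closed_Times) auto
  \<comment> \<open>If the end values have the expected signs, the intermediate value theorem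
    applies; otherwise the end with the wrong sign is itself chosen as \<open>p\<close>.\<close>
  have "\<exists>p\<in>{a..b}. (p, approx n p 1) \<in> C" for n
  proof (cases "approx n a 1 \<le> 0 \<and> 0 \<le> approx n b 1")
    case True
    have "continuous_on {a..b} (\<lambda>p. approx n p 1)"
      by (intro continuous_on_approx continuous_intros)
    then obtain p where "a \<le> p" "p \<le> b" "approx n p 1 = 0"
      using IVT'[of "\<lambda>p. approx n p 1" a 0 b] True ab by auto
    then show ?thesis
      by (auto simp: C_def)
  next
    case False
    show ?thesis
    proof (cases "approx n a 1 \<le> 0")
      case True
      with False ab show ?thesis
        by (intro bexI[of _ b]) (auto simp: C_def)
    next
      case False
      with ab show ?thesis
        by (intro bexI[of _ a]) (auto simp: C_def)
    qed
  qed
  then obtain q where q: "\<And>n. q n \<in> {a..b}" and qC: "\<And>n. (q n, approx n (q n) 1) \<in> C"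
    by metis
  obtain p w \<sigma> where p: "p \<in> {a..b}" and "strict_mono \<sigma>" and qs: "(q \<circ> \<sigma>) \<longlonglongrightarrow> p"
    and w: "ivp_solution p w" and lim: "(\<lambda>n. approx (\<sigma> n) (q (\<sigma> n)) 1) \<longlonglongrightarrow> w 1"
    by (rule approx_limit[OF q])
  have "(p, w 1) \<in> C"
    by (rule closed_sequentially[OF \<open>closed C\<close> _ tendsto_Pair[OF qs lim]]) (simp add: qC)
  \<comment> \<open>The two alternatives at the ends contradict the strict signs in
    \<open>left\<close> and \<open>right\<close>, which concern exact solutions.\<close>
  then have "w 1 = 0"
    using left[of w] right[of w] w by (auto simp: C_def)
  with p w that show thesis
    by blast
qed

end

section \<open>Monotonicity, convexity and regularity on the unit interval\<close>

lemma unit_interval_has_derivative_at: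
  assumes "(w has_real_derivative D) (at t within {0..1})" "t \<in> {0<..<1}"
  shows "(w has_real_derivative D) (at t)"
  using assms by (simp add: at_within_Icc_at)

lemma unit_interval_nonincreasing:
  fixes w :: "real \<Rightarrow> real"
  assumes w: "\<And>t. t \<in> {0..1} \<Longrightarrow> (w has_real_derivative D t) (at t within {0..1})"
    and D: "\<And>t. t \<in> {0..1} \<Longrightarrow> D t \<le> 0" and "0 \<le> r" "r \<le> s" "s \<le> 1"
  shows "w s \<le> w r"
proof (rule DERIV_nonpos_imp_decreasing_open[OF \<open>r \<le> s\<close>])
  fix t assume "r < t" "t < s"
  then show "\<exists>y. DERIV w t :> y \<and> y \<le> 0"
    using assms unit_interval_has_derivative_at[OF w] by (intro exI[of _ "D t"]) auto
next
  have "continuous_on {0..1} w"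
    using w by (rule DERIV_continuous_on)
  then show "continuous_on {r..s} w"
    by (rule continuous_on_subset) (use assms in auto)
qed

lemma unit_interval_decreasing:
  fixes w :: "real \<Rightarrow> real"
  assumes w: "\<And>t. t \<in> {0..1} \<Longrightarrow> (w has_real_derivative D t) (at t within {0..1})"
    and D: "\<And>t. t \<in> {0<..<1} \<Longrightarrow> D t < 0" and "0 \<le> r" "r < s" "s \<le> 1"
  shows "w s < w r"
proof (rule DERIV_neg_imp_decreasing_open[OF \<open>r < s\<close>])
  fix t assume "r < t" "t < s"
  then show "\<exists>y. DERIV w t :> y \<and> y < 0"
    using assms unit_interval_has_derivative_at[OF w] by (intro exI[of _ "D t"]) auto
next
  have "continuous_on {0..1} w"
    using w by (rule DERIV_continuous_on)
  then show "continuous_on {r..s} w"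
    by (rule continuous_on_subset) (use assms in auto)
qed

text \<open>The mean value theorem on either side of the intermediate point compares the two chord
  slopes through the strictly increasing derivative.\<close>

lemma strictly_convex_on_unit_interval:
  assumes g: "\<And>t. t \<in> {0<..<1} \<Longrightarrow> (g has_real_derivative g1 t) (at t)"
    and g1: "\<And>s t. 0 < s \<Longrightarrow> s < t \<Longrightarrow> t < 1 \<Longrightarrow> g1 s < g1 t"
  shows "strictly_convex_on {0<..<1} g"
proof -
  have main: "g ((1 - t) * x + t * y) < (1 - t) * g x + t * g y"
    if xy: "0 < x" "x < y" "y < 1" and t: "0 < t" "t < 1" for x y t
  proof -
    define z where "z = (1 - t) * x + t * y"
    have zx: "z - x = t * (y - x)" and yz: "y - z = (1 - t) * (y - x)"
      by (simp_all add: z_def algebra_simps)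
    have "0 < z - x" "0 < y - z"
      unfolding zx yz using xy t by simp_all
    then have "x < z" "z < y"
      by auto
    obtain u where u: "x < u" "u < z" "g z - g x = (z - x) * g1 u"
      using MVT2[OF \<open>x < z\<close>, of g g1] g xy \<open>z < y\<close> by fastforce
    obtain v where v: "z < v" "v < y" "g y - g z = (y - z) * g1 v"
      using MVT2[OF \<open>z < y\<close>, of g g1] g xy \<open>x < z\<close> by fastforce
    have "g1 u < g1 v"
      using u v xy by (intro g1) auto
    then have "(1 - t) * t * (y - x) * g1 u < (1 - t) * t * (y - x) * g1 v"
      using xy t by (intro mult_strict_left_mono) auto
    then have "(1 - t) * (g z - g x) < t * (g y - g z)"
      unfolding u(3) v(3) zx yz by (simp add: algebra_simps)
    then show ?thesis
      unfolding z_def[symmetric] by (simp add: algebra_simps)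
  qed
  show ?thesis
    unfolding strictly_convex_on_def
  proof (intro conjI ballI impI allI)
    fix x y t :: real
    assume xy: "x \<in> {0<..<1}" "y \<in> {0<..<1}" "x \<noteq> y" and t: "0 < t \<and> t < 1"
    show "g ((1 - t) * x + t * y) < (1 - t) * g x + t * g y"
    proof (cases "x < y")
      case True
      then show ?thesis
        using xy t by (intro main) auto
    next
      case False
      then show ?thesis
        using main[of y x "1 - t"] xy t by (auto simp: algebra_simps)
    qed
  qed auto
qed

lemma C2_on01_rmean:
  assumes N: "N \<ge> 1"
    and w: "\<And>t. t \<in> {0..1} \<Longrightarrow> (w has_real_derivative - (t * rmean N k t)) (at t within {0..1})"
    and k: "continuous_on {0..1} k" and nn: "\<And>x. x \<in> {0..1} \<Longrightarrow> 0 \<le> k x" and k0: "0 < k 0"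
  shows "C2_on01 w (\<lambda>t. - (t * rmean N k t)) (\<lambda>t. - (k t / rmean N k t ^ (N - 1)))"
  unfolding C2_on01_def
proof (intro conjI ballI)
  fix t :: real assume t: "t \<in> {0..1}"
  show "(w has_real_derivative - (t * rmean N k t)) (at t within {0..1})"
    using w[OF t] .
  show "((\<lambda>t. - (t * rmean N k t)) has_real_derivative - (k t / rmean N k t ^ (N - 1))) (at t within {0..1})"
    by (intro DERIV_minus rmean_has_derivative assms t)
next
  have "rmean N k t \<noteq> 0" if "t \<in> {0..1}" for t
    using rmean_pos[OF N k that nn k0] by simp
  then show "continuous_on {0..1} (\<lambda>t. - (k t / rmean N k t ^ (N - 1)))"
    by (intro continuous_intros k continuous_on_rmean) auto
qed

section \<open>Comparison with an eigenfunction\<close>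

text \<open>Replacing the argument \<open>x\<close> by the smaller \<open>t * x\<close> can only
  raise a nonincreasing function.\<close>

lemma rmean_power_antitone:
  assumes "N \<ge> 1" "continuous_on {0..1} w" "t \<in> {0..1}"
    and w0: "\<And>s. s \<in> {0..1} \<Longrightarrow> 0 \<le> w s"
    and anti: "\<And>r s. 0 \<le> r \<Longrightarrow> r \<le> s \<Longrightarrow> s \<le> 1 \<Longrightarrow> w s \<le> w r"
  shows "rmean N (\<lambda>s. w s ^ N) 1 \<le> rmean N (\<lambda>s. w s ^ N) t"
proof (rule rmean_mono_scaled)
  fix x :: real assume "x \<in> {0..1}"
  then have "w x \<le> w (t * x)"
    using assms(3) by (intro anti) (auto simp: mult_left_le_one_le)
  then show "w (1 * x) ^ N \<le> w (t * x) ^ N"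
    using w0[of x] \<open>x \<in> {0..1}\<close> by (auto intro: power_mono)
qed (use assms in \<open>auto intro!: continuous_intros\<close>)

text \<open>Integrating the differential inequality improves \<open>w \<ge> k \<phi>\<close> to \<open>w \<ge> (c / a) k \<phi>\<close>, and
  iterating makes \<open>w 0\<close> exceed every bound.\<close>

lemma eigen_comparison:
  assumes N: "N \<ge> 1" and a: "0 < a" and ac: "a < c"
    and \<phi>: "\<And>t. t \<in> {0..1} \<Longrightarrow> (\<phi> has_real_derivative - (a * t * rmean N (\<lambda>s. \<phi> s ^ N) t)) (at t within {0..1})"
    and w: "\<And>t. t \<in> {0..1} \<Longrightarrow> (w has_real_derivative - w1 t) (at t within {0..1})"
    and w1: "\<And>t. t \<in> {0..1} \<Longrightarrow> c * t * rmean N (\<lambda>s. w s ^ N) t \<le> w1 t"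
    and \<phi>nn: "\<And>t. t \<in> {0..1} \<Longrightarrow> 0 \<le> \<phi> t" and wnn: "\<And>t. t \<in> {0..1} \<Longrightarrow> 0 \<le> w t"
    and \<phi>1: "\<phi> 1 = 0" and \<phi>0: "0 < \<phi> 0" and w0: "0 < w 0"
  shows False
proof -
  have c: "0 < c"
    using a ac by simp
  have \<phi>c: "continuous_on {0..1} \<phi>" and wc: "continuous_on {0..1} w"
    using DERIV_continuous_on[OF \<phi>] DERIV_continuous_on[OF w] by blast+
  have pc: "continuous_on {0..1} (\<lambda>s. \<phi> s ^ N)" "continuous_on {0..1} (\<lambda>s. w s ^ N)"
    using \<phi>c wc by (auto intro!: continuous_intros)
  have rnn: "0 \<le> rmean N (\<lambda>s. \<phi> s ^ N) t" "0 \<le> rmean N (\<lambda>s. w s ^ N) t" if "t \<in> {0..1}" for t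
    by (intro rmean_nonneg N that zero_le_power \<phi>nn wnn; assumption)+
  have w1nn: "- w1 t \<le> 0" if "t \<in> {0..1}" for t
    using w1[OF that] rnn(2)[OF that] that c
    by (smt (verit) atLeastAtMost_iff mult_nonneg_nonneg)
  have wanti: "w s \<le> w r" if "0 \<le> r" "r \<le> s" "s \<le> 1" for r s
    using unit_interval_nonincreasing[OF w w1nn] that by blast
  have \<phi>le: "\<phi> s \<le> \<phi> 0" if "s \<in> {0..1}" for s
  proof (rule unit_interval_nonincreasing[OF \<phi>])
    show "- (a * t * rmean N (\<lambda>s. \<phi> s ^ N) t) \<le> 0" if "t \<in> {0..1}" for t
      using rnn(1)[OF that] a that by simp
  qed (use that in auto)
  \<comment> \<open>A comparison of slopes makes \<open>w - k \<phi>\<close> nonincreasing, and at 1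
    it equals \<open>w 1\<close>, which is nonnegative.\<close>
  have dominate: "k * \<phi> s \<le> w s"
    if "\<And>t. t \<in> {0..1} \<Longrightarrow> k * (a * t * rmean N (\<lambda>s. \<phi> s ^ N) t) \<le> w1 t" "s \<in> {0..1}" for k s
  proof -
    have "w 1 - k * \<phi> 1 \<le> w s - k * \<phi> s"
    proof (rule unit_interval_nonincreasing[where w = "\<lambda>t. w t - k * \<phi> t"])
      fix t :: real assume t: "t \<in> {0..1}"
      show "((\<lambda>t. w t - k * \<phi> t) has_real_derivative
          - w1 t - k * - (a * t * rmean N (\<lambda>s. \<phi> s ^ N) t)) (at t within {0..1})"
        by (intro DERIV_diff DERIV_cmult w \<phi> t)
      show "- w1 t - k * - (a * t * rmean N (\<lambda>s. \<phi> s ^ N) t) \<le> 0"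
        using that(1)[OF t] by simp
    qed (use that in auto)
    then show ?thesis
      using \<phi>1 wnn[of 1] by simp
  qed
  \<comment> \<open>The starting constant comes from two crude bounds: the mean of
    \<open>\<phi>\<close> is at most \<open>\<phi> 0\<close>, and that of \<open>w\<close> is at
    least its value at \<open>t = 1\<close>.\<close>
  define \<kappa> where "\<kappa> = c * rmean N (\<lambda>s. w s ^ N) 1"
  define k where "k = \<kappa> / (a * \<phi> 0)"
  have "0 < rmean N (\<lambda>s. w s ^ N) 1"
    using N pc wnn w0 by (intro rmean_pos) auto
  then have "0 < \<kappa>"
    using c by (simp add: \<kappa>_def)
  then have k: "0 < k"
    using a \<phi>0 by (simp add: k_def)
  have start: "k * \<phi> s \<le> w s" if "s \<in> {0..1}" for s
  proof (rule dominate[OF _ that])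
    fix t :: real assume t: "t \<in> {0..1}"
    have "rmean N (\<lambda>s. \<phi> s ^ N) t \<le> rmean N (\<lambda>s. \<phi> 0 ^ N) t"
      using N pc \<phi>le \<phi>nn t by (intro rmean_mono power_mono) auto
    also have "\<dots> = \<phi> 0"
      using N \<phi>0 by (simp add: rmean_const real_root_power_cancel)
    finally have "k * (a * t * rmean N (\<lambda>s. \<phi> s ^ N) t) \<le> k * (a * t * \<phi> 0)"
      using k a t by (intro mult_left_mono) auto
    also have "\<dots> = c * t * rmean N (\<lambda>s. w s ^ N) 1"
      using a \<phi>0 by (simp add: k_def \<kappa>_def)
    also have "\<dots> \<le> c * t * rmean N (\<lambda>s. w s ^ N) t"
      using c t rmean_power_antitone[OF N wc t wnn wanti] by (intro mult_left_mono) auto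
    also have "\<dots> \<le> w1 t"
      by (rule w1[OF t])
    finally show "k * (a * t * rmean N (\<lambda>s. \<phi> s ^ N) t) \<le> w1 t" .
  qed
  have iter: "\<forall>s\<in>{0..1}. (c / a) ^ n * k * \<phi> s \<le> w s" for n
  proof (induction n)
    case 0
    then show ?case
      using start by simp
  next
    case (Suc n)
    define l where "l = (c / a) ^ n * k"
    have l: "0 \<le> l"
      using k c a by (simp add: l_def)
    show ?case
    proof
      fix s :: real assume "s \<in> {0..1}"
      show "(c / a) ^ Suc n * k * \<phi> s \<le> w s"
      proof (rule dominate[OF _ \<open>s \<in> {0..1}\<close>])
        fix t :: real assume t: "t \<in> {0..1}"
        \<comment> \<open>By homogeneity \<open>l\<close> moves inside the mean, where the induction
          hypothesis applies; exchanging the factor \<open>a\<close> for \<open>c\<close> gains the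
          quotient \<open>c / a\<close>.\<close>
        have "l * rmean N (\<lambda>s. \<phi> s ^ N) t = rmean N (\<lambda>s. l ^ N * \<phi> s ^ N) t"
          using N l by (simp add: rmean_cmult)
        also have "\<dots> \<le> rmean N (\<lambda>s. w s ^ N) t"
        proof (rule rmean_mono)
          fix x :: real assume x: "x \<in> {0..1}"
          then have "l * \<phi> x \<le> w x"
            using Suc.IH by (simp add: l_def)
          then have "(l * \<phi> x) ^ N \<le> w x ^ N"
            using l \<phi>nn[OF x] by (intro power_mono) auto
          then show "l ^ N * \<phi> x ^ N \<le> w x ^ N"
            by (simp add: power_mult_distrib)
        qed (use N pc t in \<open>auto intro!: continuous_intros \<phi>c\<close>)
        finally have "c * t * (l * rmean N (\<lambda>s. \<phi> s ^ N) t) \<le> c * t * rmean N (\<lambda>s. w s ^ N) t"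
          using c t by (intro mult_left_mono) auto
        also have "\<dots> \<le> w1 t"
          by (rule w1[OF t])
        finally show "(c / a) ^ Suc n * k * (a * t * rmean N (\<lambda>s. \<phi> s ^ N) t) \<le> w1 t"
          using a by (simp add: l_def mult_ac)
      qed
    qed
  qed
  obtain n where "w 0 / (k * \<phi> 0) < (c / a) ^ n"
    using real_arch_pow[of "c / a" "w 0 / (k * \<phi> 0)"] a ac by auto
  then have "w 0 < (c / a) ^ n * k * \<phi> 0"
    using k \<phi>0 by (simp add: field_simps)
  moreover have "(c / a) ^ n * k * \<phi> 0 \<le> w 0"
    using iter[of n] by auto
  ultimately show False
    by simp
qed

section \<open>Qualitative properties of the shooting solutions\<close>

context shooting
begin

lemma ivp_solution_facts:
  assumes p: "p \<in> {a..b}" and w: "ivp_solution p w"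
  shows ivp_continuous: "continuous_on {0..1} (\<lambda>s. H p (w s))"
    and ivp_has_derivative: "\<And>r. r \<in> {0..1} \<Longrightarrow>
      (w has_real_derivative - (r * rmean N (\<lambda>s. H p (w s)) r)) (at r within {0..1})"
    and ivp_initial: "w 0 = d p"
    and ivp_antitone: "\<And>r s. 0 \<le> r \<Longrightarrow> r \<le> s \<Longrightarrow> s \<le> 1 \<Longrightarrow> w s \<le> w r"
proof -
  let ?k = "\<lambda>t. t * rmean N (\<lambda>s. H p (w s)) t"
  show c: "continuous_on {0..1} (\<lambda>s. H p (w s))"
    using w by (intro continuous_on_H continuous_intros) (simp add: ivp_solution_def)
  show der: "(w has_real_derivative - ?k r) (at r within {0..1})" if "r \<in> {0..1}" for r
  proof -
    have "((\<lambda>r. integral {0..r} ?k) has_real_derivative ?k r) (at r within {0..1})"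
      using that by (intro integral_has_real_derivative continuous_intros continuous_on_rmean c)
    then have "((\<lambda>r. d p - integral {0..r} ?k) has_real_derivative - ?k r) (at r within {0..1})"
      by (auto intro!: derivative_eq_intros)
    then show ?thesis
      by (rule has_field_derivative_transform_within[where d = 1])
        (use that w in \<open>auto simp: ivp_solution_def\<close>)
  qed
  have "w 0 = d p - integral {0..0} ?k"
    using w unfolding ivp_solution_def by (metis atLeastAtMost_iff order_refl zero_le_one)
  then show "w 0 = d p"
    by simp
  have "- ?k t \<le> 0" if "t \<in> {0..1}" for t
    using rmean_bounds(1)[OF p that c] that by simp
  then show "w s \<le> w r" if "0 \<le> r" "r \<le> s" "s \<le> 1" for r s
    using unit_interval_nonincreasing[OF der] that by blast
qed

text \<open>Since \<open>w' \<ge> - K t\<close>, the function \<open>w + K t^2 / 2\<close> is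
  nondecreasing. This supplies the positive end value at the right end of the parameter
  interval.\<close>

lemma ivp_endpoint_lower_bound:
  assumes p: "p \<in> {a..b}" and w: "ivp_solution p w" and "0 \<le> K" and K: "\<And>s. H p s \<le> K ^ N"
  shows "d p - K / 2 \<le> w 1"
proof -
  have "- (w 0 + K * 0\<^sup>2 / 2) \<ge> - (w 1 + K * 1\<^sup>2 / 2)"
  proof (rule unit_interval_nonincreasing[where w = "\<lambda>t. - (w t + K * t\<^sup>2 / 2)"])
    fix t :: real assume t: "t \<in> {0..1}"
    show "((\<lambda>t. - (w t + K * t\<^sup>2 / 2)) has_real_derivative
        - (- (t * rmean N (\<lambda>s. H p (w s)) t) + K * t)) (at t within {0..1})"
      using ivp_has_derivative[OF p w t] by (auto intro!: derivative_eq_intros)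
    have "rmean N (\<lambda>s. H p (w s)) t \<le> rmean N (\<lambda>s. K ^ N) t"
      using N K t ivp_continuous[OF p w] by (intro rmean_mono) auto
    also have "\<dots> = K"
      using N \<open>0 \<le> K\<close> by (simp add: rmean_const real_root_power_cancel)
    finally have "t * rmean N (\<lambda>s. H p (w s)) t \<le> t * K"
      using t by (intro mult_left_mono) auto
    then show "- (- (t * rmean N (\<lambda>s. H p (w s)) t) + K * t) \<le> 0"
      by (simp add: mult.commute)
  qed auto
  then show ?thesis
    using ivp_initial[OF p w] by simp
qed

text \<open>\<open>H p (d p) > 0\<close> makes all means positive, so \<open>w\<close> strictly
  decreases to its end value 0. The double minus is \<open>- w1\<close> for
  \<open>w1 t = - (t * r t)\<close>, the form used by \<open>eig_solution\<close>.\<close>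

lemma ivp_zero_endpoint:
  assumes p: "p \<in> {a..b}" and w: "ivp_solution p w" and w1: "w 1 = 0" and Hd: "0 < H p (d p)"
  defines "r \<equiv> rmean N (\<lambda>s. H p (w s))"
  shows ivp_C2: "C2_on01 w (\<lambda>t. - (t * r t)) (\<lambda>t. - (H p (w t) / r t ^ (N - 1)))"
    and ivp_ode: "\<And>t. t \<in> {0<..<1} \<Longrightarrow>
      ((\<lambda>s. (- (- (s * r s))) ^ N) has_real_derivative real N * t ^ (N - 1) * H p (w t)) (at t)"
    and ivp_rmean_pos: "\<And>t. t \<in> {0..1} \<Longrightarrow> 0 < r t"
    and ivp_pos: "\<And>t. t \<in> {0<..<1} \<Longrightarrow> 0 < w t"
proof -
  have k0: "0 < H p (w 0)"
    using Hd ivp_initial[OF p w] by simp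
  show "C2_on01 w (\<lambda>t. - (t * r t)) (\<lambda>t. - (H p (w t) / r t ^ (N - 1)))"
    unfolding r_def
    by (rule C2_on01_rmean[OF N ivp_has_derivative[OF p w] ivp_continuous[OF p w] H_nonneg[OF p] k0])
  show rpos: "0 < r t" if "t \<in> {0..1}" for t
    unfolding r_def by (rule rmean_pos[OF N ivp_continuous[OF p w] that H_nonneg[OF p] k0])
  fix t :: real assume t: "t \<in> {0<..<1}"
  then have t': "t \<in> {0..1}"
    by auto
  show "((\<lambda>s. (- (- (s * r s))) ^ N) has_real_derivative real N * t ^ (N - 1) * H p (w t)) (at t)"
    using unit_interval_has_derivative_at[OF
        rmean_power_has_derivative[OF N ivp_continuous[OF p w] t' H_nonneg[OF p]] t]
    by (simp add: r_def)
  have "w 1 < w t"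
  proof (rule unit_interval_decreasing[OF ivp_has_derivative[OF p w]])
    fix s :: real assume "s \<in> {0<..<1}"
    then show "- (s * rmean N (\<lambda>s. H p (w s)) s) < 0"
      using rpos[of s] by (simp add: r_def)
  qed (use t in auto)
  then show "0 < w t"
    using w1 by simp
qed

end

section \<open>Existence and uniqueness of the first eigenvalue\<close>

text \<open>The equation controls only the N-th power of \<open>v'\<close>, so for even
  \<open>N\<close> its sign must be recovered: \<open>v'\<close> has no zero on
  \<open>(0,1]\<close>, is negative somewhere because \<open>v\<close> falls to 0, and hence is
  negative throughout.\<close>

lemma eig_solution_first_integral:
  assumes N: "N \<ge> 1" and \<mu>: "0 < \<mu>" and eig: "eig_solution N \<mu> v" and pos: "\<forall>r\<in>{0<..<1}. 0 < v r"
  shows "\<And>t. t \<in> {0..1} \<Longrightarrow> (v has_real_derivative - (\<mu> * t * rmean N (\<lambda>s. v s ^ N) t)) (at t within {0..1})"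
    and "\<And>t. t \<in> {0..1} \<Longrightarrow> 0 \<le> v t" and "v 1 = 0" and "0 < v 0"
proof -
  obtain v1 v2 where C2: "C2_on01 v v1 v2"
    and ode: "\<And>r. r \<in> {0<..<1} \<Longrightarrow> ((\<lambda>s. (- v1 s) ^ N) has_real_derivative
             \<mu> ^ N * real N * r ^ (N - 1) * v r ^ N) (at r)"
    and v10: "v1 0 = 0" and v_1: "v 1 = 0"
    using eig unfolding eig_solution_def by blast
  have dv: "(v has_real_derivative v1 t) (at t within {0..1})"
    and dv1: "(v1 has_real_derivative v2 t) (at t within {0..1})" if "t \<in> {0..1}" for t
    using C2 that unfolding C2_on01_def by auto
  have vc: "continuous_on {0..1} v" and v1c: "continuous_on {0..1} v1"
    using DERIV_continuous_on[OF dv] DERIV_continuous_on[OF dv1] by blast+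
  have v0: "0 \<le> v 0"
  proof (rule continuous_ge_on_closure[of "{0<..<1}" v 0 0])
    show "continuous_on (closure {0<..<1}) v"
      using vc by simp
  qed (use pos in \<open>auto intro: less_imp_le\<close>)
  have vnn: "0 \<le> v t" if "t \<in> {0..1}" for t
    using that pos v0 v_1 by (cases "t = 0 \<or> t = 1") (auto intro: less_imp_le)
  define k where "k s = \<mu> ^ N * v s ^ N" for s
  have kc: "continuous_on {0..1} k"
    unfolding k_def by (intro continuous_intros vc)
  have knn: "0 \<le> k s" if "s \<in> {0..1}" for s
    unfolding k_def using vnn[OF that] \<mu> by simp
  define E where "E t = (t * rmean N k t) ^ N" for t
  have Ec: "continuous_on {0..1} E"
    unfolding E_def by (intro continuous_intros continuous_on_rmean kc)
  have Ed: "(E has_real_derivative \<mu> ^ N * real N * t ^ (N - 1) * v t ^ N) (at t)" if "t \<in> {0<..<1}" for t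
    using unit_interval_has_derivative_at[OF rmean_power_has_derivative[OF N kc _ knn] that] that
    by (simp add: E_def[abs_def] k_def[of t] mult_ac)
  have E0: "E 0 = 0"
    using N by (simp add: E_def)
  have Epos: "0 < E t" if "t \<in> {0<..1}" for t
  proof -
    have "E 0 < E t"
    proof (rule DERIV_pos_imp_increasing_open[of 0 t E])
      fix x assume "0 < x" "x < t"
      with that have "x \<in> {0<..<1}"
        by auto
      then show "\<exists>y. DERIV E x :> y \<and> 0 < y"
        using Ed pos N \<mu> by (intro exI[of _ "\<mu> ^ N * real N * x ^ (N - 1) * v x ^ N"]) auto
    qed (use that in \<open>auto intro: continuous_on_subset[OF Ec]\<close>)
    then show ?thesis
      using E0 by simp
  qed
  \<comment> \<open>Both sides have the same derivative and vanish at 0.\<close>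
  have G: "(- v1 t) ^ N = E t" if "t \<in> {0..1}" for t
  proof -
    have "(- v1 t) ^ N - E t = (- v1 0) ^ N - E 0"
    proof (rule DERIV_isconst2[of 0 1 "\<lambda>t. (- v1 t) ^ N - E t"])
      show "continuous_on {0..1} (\<lambda>t. (- v1 t) ^ N - E t)"
        by (intro continuous_intros v1c Ec)
      show "((\<lambda>t. (- v1 t) ^ N - E t) has_real_derivative 0) (at x)" if "0 < x" "x < 1" for x
        using DERIV_diff[OF ode Ed, of x] that by simp
    qed (use that in auto)
    then show ?thesis
      using N v10 E0 by (simp add: zero_power)
  qed
  have v1_nz: "v1 t \<noteq> 0" if "t \<in> {0<..1}" for t
    using G[of t] Epos[OF that] that N by (auto simp: zero_power)
  \<comment> \<open>Were \<open>v1\<close> nonnegative on \<open>(1/2,1)\<close>, then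
    \<open>v (1/2) \<le> v 1 = 0\<close>, against positivity.\<close>
  obtain \<xi> where \<xi>: "1/2 < \<xi>" "\<xi> < 1" "v1 \<xi> < 0"
  proof (rule ccontr)
    assume no: "\<not> thesis"
    have "v (1/2) \<le> v 1"
    proof (rule DERIV_nonneg_imp_increasing_open[of "1/2" 1 v])
      fix x :: real assume x: "1/2 < x" "x < 1"
      then have "0 \<le> v1 x"
        using that no by force
      then show "\<exists>y. DERIV v x :> y \<and> 0 \<le> y"
        using x unit_interval_has_derivative_at[OF dv, of x] by (intro exI[of _ "v1 x"]) auto
    qed (auto intro: continuous_on_subset[OF vc])
    moreover have "0 < v (1/2)"
      using pos by simp
    ultimately show False
      using v_1 by simp
  qed
  have v1_neg: "v1 t < 0" if t: "t \<in> {0<..1}" for t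
  proof (rule ccontr)
    assume "\<not> v1 t < 0"
    moreover have "connected (v1 ` {0<..1})"
      by (intro connected_continuous_image continuous_on_subset[OF v1c]) auto
    moreover have "v1 \<xi> \<in> v1 ` {0<..1}" "v1 t \<in> v1 ` {0<..1}"
      using \<xi> t by auto
    ultimately have "0 \<in> v1 ` {0<..1}"
      using \<xi>(3) connectedD_interval[of "v1 ` {0<..1}" "v1 \<xi>" "v1 t" 0] by auto
    then show False
      using v1_nz by force
  qed
  have v1_eq: "v1 t = - (\<mu> * t * rmean N (\<lambda>s. v s ^ N) t)" if t: "t \<in> {0..1}" for t
  proof -
    have "0 \<le> - v1 t"
      using v1_neg[of t] v10 t by (cases "t = 0") auto
    moreover have "0 \<le> t * rmean N k t"
      using t N knn by (intro mult_nonneg_nonneg rmean_nonneg) auto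
    ultimately have "- v1 t = t * rmean N k t"
      using G[OF t] N unfolding E_def by (subst (asm) power_eq_iff_eq_base) auto
    moreover have "rmean N k t = \<mu> * rmean N (\<lambda>s. v s ^ N) t"
      unfolding k_def using N \<mu> by (simp add: rmean_cmult)
    ultimately show ?thesis
      by (simp add: mult_ac)
  qed
  show "(v has_real_derivative - (\<mu> * t * rmean N (\<lambda>s. v s ^ N) t)) (at t within {0..1})"
    if "t \<in> {0..1}" for t
    using dv[OF that] v1_eq[OF that] by simp
  show "\<And>t. t \<in> {0..1} \<Longrightarrow> 0 \<le> v t"
    by (rule vnn)
  show "v 1 = 0"
    by (rule v_1)
  have "v (1/2) < v 0"
  proof (rule unit_interval_decreasing[where w = v and D = v1])
    show "v1 t < 0" if "t \<in> {0<..<1}" for t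
      using that by (intro v1_neg) simp
  qed (simp_all add: dv)
  moreover have "0 < v (1/2)"
    using pos by simp
  ultimately show "0 < v 0"
    by linarith
qed

text \<open>For two distinct eigenvalues, \<open>eigen_comparison\<close> applies with
  \<open>\<phi>\<close> belonging to the smaller and \<open>w\<close> to the larger.\<close>

lemma eigenvalue_unique:
  assumes N: "N \<ge> 1"
    and "0 < \<mu>" "eig_solution N \<mu> v" "\<forall>r\<in>{0<..<1}. 0 < v r"
    and "0 < \<nu>" "eig_solution N \<nu> u" "\<forall>r\<in>{0<..<1}. 0 < u r"
  shows "\<mu> = \<nu>"
proof -
  have False if "0 < a" "a < c" "eig_solution N a \<phi>" "\<forall>r\<in>{0<..<1}. 0 < \<phi> r"
      "eig_solution N c w" "\<forall>r\<in>{0<..<1}. 0 < w r" for a c \<phi> w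
  proof -
    have "0 < c"
      using that by simp
    note \<phi> = eig_solution_first_integral[OF N that(1,3,4)]
    note w = eig_solution_first_integral[OF N \<open>0 < c\<close> that(5,6)]
    show False
      by (rule eigen_comparison[OF N that(1,2) \<phi>(1) w(1) order_refl \<phi>(2) w(2) \<phi>(3,4) w(4)])
  qed
  then show ?thesis
    using assms by (metis linorder_neqE)
qed

text \<open>Shooting in the eigenvalue \<open>L - p\<close> with \<open>w 0 = 1\<close>. The minus
  sign puts the large eigenvalue, for which \<open>w\<close> falls below 0, at the left end as
  \<open>shooting_root\<close> demands; at the right end the eigenvalue is 1 and
  \<open>w 1 \<ge> 1/2\<close>.\<close>

lemma eigenvalue_exists:
  assumes N: "N \<ge> 1"
  obtains \<mu> v where "0 < \<mu>" "eig_solution N \<mu> v" "\<forall>r\<in>{0<..<1}. 0 < v r"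
proof -
  define B where "B = rmean N (\<lambda>x. (1 - x\<^sup>2) ^ N) 1"
  have sq: "0 \<le> 1 - x\<^sup>2" if "x \<in> {0..1}" for x :: real
    using that by (simp add: power_le_one)
  have B: "0 < B"
    unfolding B_def using N sq by (intro rmean_pos) (auto intro!: continuous_intros)
  define L where "L = 2 / B + 2"
  have L: "2 < L" "2 < L * B"
    using B by (auto simp: L_def field_simps)
  \<comment> \<open>The truncation to \<open>[0,1]\<close> bounds \<open>H\<close>; a solution with
    \<open>w 1 \<ge> 0\<close> decreases from 1 and never leaves this range.\<close>
  define H where "H p s = (L - p) ^ N * min (max s 0) 1 ^ N" for p s :: real
  have Hle: "H p s \<le> K ^ N" if "0 \<le> L - p" "L - p \<le> K" for p s K
  proof -
    have "H p s \<le> K ^ N * 1 ^ N"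
      unfolding H_def using that by (intro mult_mono power_mono) auto
    then show ?thesis
      by simp
  qed
  interpret shooting N H "\<lambda>_. 1" 0 "L - 1" "L ^ N"
  proof
    show "continuous_on UNIV (\<lambda>(p, s). H p s)"
      unfolding H_def case_prod_unfold by (intro continuous_intros)
    show "0 \<le> H p s" if "p \<in> {0..L - 1}" for p s
      unfolding H_def using that by simp
    show "H p s \<le> L ^ N" if "p \<in> {0..L - 1}" for p s
      using that by (intro Hle) auto
  qed (use N L in auto)
  have Heq: "H p (w s) = (L - p) ^ N * w s ^ N"
    if "p \<in> {0..L - 1}" "ivp_solution p w" "0 \<le> w 1" "s \<in> {0..1}" for p w s
  proof -
    have "w 1 \<le> w s" "w s \<le> w 0"
      using ivp_antitone[OF that(1,2)] that(4) by auto
    then show ?thesis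
      using that ivp_initial[OF that(1,2)] by (simp add: H_def)
  qed
  have der: "(w has_real_derivative - ((L - p) * t * rmean N (\<lambda>s. w s ^ N) t)) (at t within {0..1})"
    if "p \<in> {0..L - 1}" "ivp_solution p w" "0 \<le> w 1" "t \<in> {0..1}" for p w t
  proof -
    have "rmean N (\<lambda>s. H p (w s)) t = rmean N (\<lambda>s. (L - p) ^ N * w s ^ N) t"
      by (intro rmean_cong Heq that)
    also have "\<dots> = (L - p) * rmean N (\<lambda>s. w s ^ N) t"
      using that N by (intro rmean_cmult) auto
    finally show ?thesis
      using ivp_has_derivative[OF that(1,2,4)] by (simp add: mult_ac)
  qed
  have p0: "0 \<in> {0..L - 1}" and pL: "L - 1 \<in> {0..L - 1}"
    using L by auto
  have left: "w 1 < 0" if w: "ivp_solution 0 w" for w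
  proof (rule ccontr)
    assume "\<not> w 1 < 0"
    then have w1: "0 \<le> w 1"
      by simp
    have wc: "continuous_on {0..1} w"
      using w by (simp add: ivp_solution_def)
    have wnn: "0 \<le> w s" if "s \<in> {0..1}" for s
      using ivp_antitone[OF p0 w, of s 1] w1 that by auto
    have w_0: "w 0 = 1"
      by (rule ivp_initial[OF p0 w])
    \<comment> \<open>\<open>m\<close> is the least of the means, so integrating gives
      \<open>w \<ge> (L m / 2) (1 - s^2)\<close>. Taking the mean at 1 again yields
      \<open>m \<ge> L m B / 2\<close>, which the choice of \<open>L\<close> with
      \<open>L * B > 2\<close> excludes.\<close>
    define m where "m = rmean N (\<lambda>s. w s ^ N) 1"
    have m: "0 < m"
      unfolding m_def using N wnn w_0 by (intro rmean_pos) (auto intro!: continuous_intros wc)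
    have lower: "L * m / 2 * (1 - s\<^sup>2) \<le> w s" if s: "s \<in> {0..1}" for s
    proof -
      have "w 1 - L * m / 2 * (1 - 1\<^sup>2) \<le> w s - L * m / 2 * (1 - s\<^sup>2)"
      proof (rule unit_interval_nonincreasing[where w = "\<lambda>s. w s - L * m / 2 * (1 - s\<^sup>2)"])
        fix t :: real assume t: "t \<in> {0..1}"
        show "((\<lambda>s. w s - L * m / 2 * (1 - s\<^sup>2)) has_real_derivative
            - (L * t * rmean N (\<lambda>s. w s ^ N) t) + L * m * t) (at t within {0..1})"
          using der[OF p0 w w1 t] by (auto intro!: derivative_eq_intros)
        have "m \<le> rmean N (\<lambda>s. w s ^ N) t"
          unfolding m_def by (rule rmean_power_antitone[OF N wc t wnn ivp_antitone[OF p0 w]])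
        then have "L * t * m \<le> L * t * rmean N (\<lambda>s. w s ^ N) t"
          using t L by (intro mult_left_mono) auto
        then show "- (L * t * rmean N (\<lambda>s. w s ^ N) t) + L * m * t \<le> 0"
          by (simp add: mult_ac)
      qed (use s in auto)
      then show ?thesis
        using w1 by simp
    qed
    have "L * m / 2 * B = rmean N (\<lambda>x. (L * m / 2) ^ N * (1 - x\<^sup>2) ^ N) 1"
      unfolding B_def using N L m by (simp add: rmean_cmult)
    also have "\<dots> \<le> m"
      unfolding m_def
    proof (rule rmean_mono)
      fix x :: real assume x: "x \<in> {0..1}"
      have "(L * m / 2 * (1 - x\<^sup>2)) ^ N \<le> w x ^ N"
        using lower[OF x] sq[OF x] L m by (intro power_mono mult_nonneg_nonneg) auto
      then show "(L * rmean N (\<lambda>s. w s ^ N) 1 / 2) ^ N * (1 - x\<^sup>2) ^ N \<le> w x ^ N"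
        by (simp only: m_def power_mult_distrib)
    qed (use N in \<open>auto intro!: continuous_intros wc\<close>)
    finally have "L * B \<le> 2"
      using m by (simp add: field_simps)
    then show False
      using L by simp
  qed
  have right: "w 1 > 0" if w: "ivp_solution (L - 1) w" for w
    using ivp_endpoint_lower_bound[OF pL w, of 1] Hle[of "L - 1" 1] by simp
  obtain p w where p: "p \<in> {0..L - 1}" and w: "ivp_solution p w" and w1: "w 1 = 0"
    by (rule shooting_root) (use left right in blast)+
  have Hd: "0 < H p 1"
    using p by (simp add: H_def)
  let ?r = "rmean N (\<lambda>s. H p (w s))"
  have ode: "((\<lambda>s. (- (- (s * ?r s))) ^ N) has_real_derivative
      (L - p) ^ N * real N * t ^ (N - 1) * w t ^ N) (at t)" if "t \<in> {0<..<1}" for t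
  proof -
    have "H p (w t) = (L - p) ^ N * w t ^ N"
      using w1 that by (intro Heq[OF p w]) auto
    then show ?thesis
      using ivp_ode[OF p w w1 Hd that] by (simp add: mult_ac)
  qed
  have "eig_solution N (L - p) w"
    unfolding eig_solution_def
    by (rule exI[of _ "\<lambda>t. - (t * ?r t)"], rule exI, intro conjI ballI, rule ivp_C2[OF p w w1 Hd])
      (use ode w1 in auto)
  moreover have "0 < L - p"
    using p by simp
  ultimately show thesis
    using that ivp_pos[OF p w w1 Hd] by blast
qed

text \<open>Existence and uniqueness together make the definite description in
  \<open>lambda1\<close> meaningful.\<close>

lemma lambda1_eigenvalue:
  assumes "N \<ge> 1"
  shows "0 < lambda1 N" "\<exists>v. eig_solution N (lambda1 N) v \<and> (\<forall>r\<in>{0<..<1}. 0 < v r)"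
proof -
  have "\<exists>!lam. 0 < lam \<and> (\<exists>v. eig_solution N lam v \<and> (\<forall>r\<in>{0<..<1}. 0 < v r))"
    using eigenvalue_exists[OF assms] eigenvalue_unique[OF assms] by (metis (no_types, lifting))
  from theI'[OF this] show "0 < lambda1 N" "\<exists>v. eig_solution N (lambda1 N) v \<and> (\<forall>r\<in>{0<..<1}. 0 < v r)"
    unfolding lambda1_def by blast+
qed

section \<open>Positive solutions of the nonlinear problem\<close>

text \<open>The limits are one-sided and positivity is asked on positive arguments, so that
  \<open>f\<close> and its reflection both qualify as \<open>g\<close>. Strict decrease of
  \<open>w1\<close> is recorded for the concavity claim.\<close>

lemma positive_solution:
  fixes g :: "real \<Rightarrow> real"
  assumes N: "N \<ge> 1" and g: "continuous_on UNIV g" and gpos: "\<And>s. 0 < s \<Longrightarrow> 0 < g s"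
    and f0: "0 < f0"
    and lim0: "((\<lambda>s. g s / s ^ N) \<longlongrightarrow> f0 ^ N) (at_right 0)"
    and liminf: "((\<lambda>s. g s / s ^ N) \<longlongrightarrow> 0) at_top"
    and lam: "lambda1 N / f0 < lam"
  obtains w w1 w2 where "C2_on01 w w1 w2"
    "\<And>t. t \<in> {0<..<1} \<Longrightarrow>
      ((\<lambda>s. (- w1 s) ^ N) has_real_derivative lam ^ N * real N * t ^ (N - 1) * g (w t)) (at t)"
    "w1 0 = 0" "w 1 = 0" "\<And>t. t \<in> {0<..<1} \<Longrightarrow> 0 < w t"
    "\<And>s t. 0 < s \<Longrightarrow> s < t \<Longrightarrow> t < 1 \<Longrightarrow> w1 t < w1 s"
proof -
  obtain \<phi> where \<phi>: "eig_solution N (lambda1 N) \<phi>" "\<forall>r\<in>{0<..<1}. 0 < \<phi> r"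
    using lambda1_eigenvalue(2)[OF N] by blast
  have l1: "0 < lambda1 N"
    by (rule lambda1_eigenvalue(1)[OF N])
  have "0 < lambda1 N / f0"
    using l1 f0 by simp
  then have lam0: "0 < lam"
    using lam by simp
  have "lambda1 N < lam * f0"
    using lam f0 by (simp add: field_simps)
  \<comment> \<open>The gap between \<open>lambda1 N\<close> and \<open>c\<close> provides the fixed
    improvement factor \<open>c / lambda1 N > 1\<close>; the gap below \<open>lam * f0\<close>
    absorbs the error of the limit at 0.\<close>
  then obtain c where c: "lambda1 N < c" "c < lam * f0"
    using dense by blast
  have g0: "0 \<le> g 0"
    by (rule continuous_ge_on_closure[of "{0<..}" g 0 0])
      (auto intro: less_imp_le gpos continuous_on_subset[OF g])
  have gnn: "0 \<le> g s" if "0 \<le> s" for s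
    using gpos[of s] g0 that by (cases "s = 0") auto
  have "(c / lam) ^ N < f0 ^ N"
    using c l1 lam0 f0 N by (intro power_strict_mono) (auto simp: field_simps)
  then have "eventually (\<lambda>s. (c / lam) ^ N < g s / s ^ N) (at_right 0)"
    by (rule order_tendstoD(1)[OF lim0])
  then obtain \<delta> where \<delta>: "0 < \<delta>" and \<delta>g: "\<And>s. 0 < s \<Longrightarrow> s < \<delta> \<Longrightarrow> (c / lam) ^ N < g s / s ^ N"
    unfolding eventually_at_right_field by blast
  define a where "a = \<delta> / 2"
  have a: "0 < a" "a < \<delta>"
    using \<delta> by (auto simp: a_def)
  have small: "c ^ N * s ^ N \<le> lam ^ N * g s" if "0 \<le> s" "s \<le> a" for s
  proof (cases "s = 0")
    case True
    then show ?thesis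
      using N g0 lam0 by (simp add: zero_power)
  next
    case False
    then have "(c / lam) ^ N < g s / s ^ N"
      using that a by (intro \<delta>g) auto
    then show ?thesis
      using False that lam0 by (simp add: field_simps)
  qed
  have "eventually (\<lambda>s. g s / s ^ N < (1 / lam) ^ N) at_top"
    using lam0 by (intro order_tendstoD(2)[OF liminf]) simp
  then obtain R where R: "\<And>s. R \<le> s \<Longrightarrow> g s / s ^ N < (1 / lam) ^ N"
    unfolding eventually_at_top_linorder by blast
  have "bounded (g ` {0..\<bar>R\<bar>})"
    by (intro compact_imp_bounded compact_continuous_image continuous_on_subset[OF g]) auto
  then obtain C where C: "\<And>s. s \<in> {0..\<bar>R\<bar>} \<Longrightarrow> \<bar>g s\<bar> \<le> C"
    unfolding bounded_iff by force
  \<comment> \<open>The choice ensures \<open>g \<le> (b / lam)^N\<close> on \<open>[0,b]\<close>: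
    up to \<open>\<bar>R\<bar>\<close> through \<open>C \<le> b / lam\<close> and
    \<open>1 \<le> b / lam\<close>, beyond it through the sublinear bound
    \<open>g s < (s / lam)^N\<close>. Then \<open>H \<le> b^N\<close>, and the end value for
    \<open>p = b\<close> is at least \<open>b - b / 2\<close>.\<close>
  define b where "b = max a (max lam (lam * C))"
  have b: "a \<le> b" "lam \<le> b" "lam * C \<le> b"
    by (auto simp: b_def)
  have b0: "0 < b"
    using a b by simp
  have gle: "g s \<le> (b / lam) ^ N" if s: "0 \<le> s" "s \<le> b" for s
  proof (cases "s \<le> \<bar>R\<bar>")
    case True
    have "g s \<le> C"
      using C[of s] True s by auto
    also have "C \<le> b / lam"
      using b lam0 by (simp add: field_simps)
    also have "\<dots> \<le> (b / lam) ^ N"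
      using b lam0 N by (intro self_le_power) (auto simp: field_simps)
    finally show ?thesis .
  next
    case False
    then have "g s / s ^ N < (1 / lam) ^ N"
      by (intro R) auto
    then have "g s < (s / lam) ^ N"
      using False lam0 by (simp add: field_simps)
    also have "\<dots> \<le> (b / lam) ^ N"
      using s lam0 by (intro power_mono divide_right_mono) auto
    finally show ?thesis
      by simp
  qed
  \<comment> \<open>Solutions with \<open>w 1 \<ge> 0\<close> satisfy
    \<open>0 \<le> w \<le> p \<le> b\<close>, so the truncation does not affect them.\<close>
  define H where "H p s = lam ^ N * g (min (max s 0) b)" for p s :: real
  have Hle: "H p s \<le> b ^ N" for p s
  proof -
    have "H p s \<le> lam ^ N * (b / lam) ^ N"
      unfolding H_def using b0 lam0 by (intro mult_left_mono gle) auto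
    then show ?thesis
      using lam0 by (simp add: power_divide)
  qed
  interpret shooting N H "\<lambda>p. p" a b "b ^ N"
  proof
    show "continuous_on UNIV (\<lambda>(p, s). H p s)"
      unfolding H_def case_prod_unfold
      by (intro continuous_intros continuous_on_compose2[OF g]) auto
    show "0 \<le> H p s" for p s
      unfolding H_def using lam0 b0 by (intro mult_nonneg_nonneg gnn) auto
  qed (use N b Hle in \<open>auto intro!: continuous_intros\<close>)
  have range: "w s \<in> {0..p}" if "p \<in> {a..b}" "ivp_solution p w" "0 \<le> w 1" "s \<in> {0..1}" for p w s
    using ivp_antitone[OF that(1,2), of s 1] ivp_antitone[OF that(1,2), of 0 s] ivp_initial[OF that(1,2)] that
    by auto
  have Heq: "H p (w s) = lam ^ N * g (w s)"
    if "p \<in> {a..b}" "ivp_solution p w" "0 \<le> w 1" "s \<in> {0..1}" for p w s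
    using range[OF that] that(1) by (simp add: H_def)
  have pa: "a \<in> {a..b}" and pb: "b \<in> {a..b}"
    using b by auto
  \<comment> \<open>If \<open>w 1 \<ge> 0\<close>, then \<open>w\<close> stays in
    \<open>[0,a]\<close>, where \<open>small\<close> bounds the nonlinearity below by
    \<open>c^N w^N\<close>; this contradicts \<open>eigen_comparison\<close>, as \<open>c\<close>
    exceeds \<open>lambda1 N\<close>.\<close>
  have left: "w 1 < 0" if w: "ivp_solution a w" for w
  proof (rule ccontr)
    assume "\<not> w 1 < 0"
    then have w1: "0 \<le> w 1"
      by simp
    have wc: "continuous_on {0..1} w"
      using w by (simp add: ivp_solution_def)
    have wnn: "0 \<le> w s" if "s \<in> {0..1}" for s
      using range[OF pa w w1 that] by simp
    have w_0: "0 < w 0"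
      using ivp_initial[OF pa w] a by simp
    have c0: "0 \<le> c"
      using c l1 by simp
    have ineq: "c * t * rmean N (\<lambda>s. w s ^ N) t \<le> t * rmean N (\<lambda>s. H a (w s)) t" if t: "t \<in> {0..1}" for t
    proof -
      have "c * rmean N (\<lambda>s. w s ^ N) t = rmean N (\<lambda>s. c ^ N * w s ^ N) t"
        by (rule rmean_cmult[OF N c0, symmetric])
      also have "\<dots> \<le> rmean N (\<lambda>s. H a (w s)) t"
      proof (rule rmean_mono[OF N _ ivp_continuous[OF pa w] t])
        fix x :: real assume x: "x \<in> {0..1}"
        show "c ^ N * w x ^ N \<le> H a (w x)"
          using small[of "w x"] range[OF pa w w1 x] Heq[OF pa w w1 x] by simp
      qed (intro continuous_intros wc)
      finally have "t * (c * rmean N (\<lambda>s. w s ^ N) t) \<le> t * rmean N (\<lambda>s. H a (w s)) t"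
        using t by (intro mult_left_mono) auto
      then show ?thesis
        by (simp add: mult_ac)
    qed
    note \<phi>' = eig_solution_first_integral[OF N l1 \<phi>]
    show False
      by (rule eigen_comparison[OF N l1 c(1) \<phi>'(1) ivp_has_derivative[OF pa w] ineq \<phi>'(2) wnn \<phi>'(3,4) w_0])
  qed
  have right: "w 1 > 0" if w: "ivp_solution b w" for w
    using ivp_endpoint_lower_bound[OF pb w, of b] Hle b0 by simp
  obtain p w where p: "p \<in> {a..b}" and w: "ivp_solution p w" and w1: "w 1 = 0"
    by (rule shooting_root) (use left right in blast)+
  have Hd: "0 < H p p"
    using p a lam0 gpos[of p] by (simp add: H_def)
  have Hw: "H p (w t) = lam ^ N * g (w t)" if "t \<in> {0..1}" for t
    using Heq[OF p w _ that] w1 by simp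
  note C2 = ivp_C2[OF p w w1 Hd]
  show thesis
  proof (rule that[OF C2 _ _ w1 ivp_pos[OF p w w1 Hd]])
    fix t :: real assume "t \<in> {0<..<1}"
    then show "((\<lambda>s. (- (- (s * rmean N (\<lambda>s. H p (w s)) s))) ^ N) has_real_derivative
        lam ^ N * real N * t ^ (N - 1) * g (w t)) (at t)"
      using ivp_ode[OF p w w1 Hd, of t] Hw[of t] by (simp add: mult_ac)
  next
    let ?w1 = "\<lambda>t. - (t * rmean N (\<lambda>s. H p (w s)) t)"
    fix s t :: real assume "0 < s" "s < t" "t < 1"
    have "?w1 t < ?w1 s"
    proof (rule unit_interval_decreasing[where w = ?w1])
      show "(?w1 has_real_derivative - (H p (w t) / rmean N (\<lambda>s. H p (w s)) t ^ (N - 1))) (at t within {0..1})"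
        if "t \<in> {0..1}" for t
        using C2 that unfolding C2_on01_def by blast
      show "- (H p (w t) / rmean N (\<lambda>s. H p (w s)) t ^ (N - 1)) < 0" if "t \<in> {0<..<1}" for t
        using that Hw[of t] lam0 gpos[of "w t"] ivp_pos[OF p w w1 Hd, of t] ivp_rmean_pos[OF p w w1 Hd, of t]
        by simp
    qed (use \<open>0 < s\<close> \<open>s < t\<close> \<open>t < 1\<close> in auto)
    then show "?w1 t < ?w1 s" .
  qed auto
qed

section \<open>The positive and the negative solution\<close>

theorem theorem4p2:
  fixes N :: nat and f :: "real \<Rightarrow> real" and f0 lam :: real
  assumes "N \<ge> 1"
    and f1_cont: "continuous_on UNIV f"
    and f1_sign: "\<forall>s. s \<noteq> 0 \<longrightarrow> f s * s ^ N > 0"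
    and f0_pos: "0 < f0"
    and f0_lim: "((\<lambda>s. f s / s ^ N) \<longlongrightarrow> f0 ^ N) (at 0)"
    and finf_lim: "((\<lambda>s. f s / s ^ N) \<longlongrightarrow> 0) at_infinity"
    and lam: "lam > lambda1 N / f0"
  shows "\<exists>up um. MO_solution N f lam up \<and> MO_solution N f lam um \<and>
           (\<forall>r\<in>{0<..<1}. 0 < up r) \<and> strictly_concave_on {0<..<1} up \<and>
           (\<forall>r\<in>{0<..<1}. um r < 0) \<and> strictly_convex_on {0<..<1} um"
proof -
  have convex: "strictly_convex_on {0<..<1} (\<lambda>x. - w x)"
    if C2: "C2_on01 w w1 w2" and dec: "\<And>s t. 0 < s \<Longrightarrow> s < t \<Longrightarrow> t < 1 \<Longrightarrow> w1 t < w1 s" for w w1 w2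
  proof (rule strictly_convex_on_unit_interval)
    fix t :: real assume t: "t \<in> {0<..<1}"
    then have "(w has_real_derivative w1 t) (at t within {0..1})"
      using C2 unfolding C2_on01_def by auto
    then show "((\<lambda>x. - w x) has_real_derivative - w1 t) (at t)"
      using t by (intro DERIV_minus unit_interval_has_derivative_at)
  qed (use dec in auto)
  \<comment> \<open>Through this identity the reflected nonlinearity inherits both limits of
    \<open>f\<close>.\<close>
  have fneg: "(- 1) ^ N * f (- s) / s ^ N = f (- s) / (- s) ^ N" for s
    by (cases "even N") auto
  have "\<exists>up. MO_solution N f lam up \<and> (\<forall>r\<in>{0<..<1}. 0 < up r) \<and> strictly_concave_on {0<..<1} up"
  proof -
    \<comment> \<open>The sign makes \<open>g\<close> positive on positive arguments and cancels the
      one in \<open>(- w1)^N = (- 1)^N w1^N\<close>.\<close>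
    define g where "g s = (- 1) ^ N * f (- s)" for s
    have gc: "continuous_on UNIV g"
      unfolding g_def by (intro continuous_intros continuous_on_compose2[OF f1_cont]) auto
    have gpos: "0 < g s" if "0 < s" for s
    proof -
      have "0 < f (- s) * (- s) ^ N"
        using f1_sign that by auto
      also have "\<dots> = g s * s ^ N"
        unfolding g_def by (cases "even N") auto
      finally show ?thesis
        using that by (simp add: zero_less_mult_iff)
    qed
    have "((\<lambda>s. f (- s) / (- s) ^ N) \<longlongrightarrow> f0 ^ N) (at_right 0)"
      using f0_lim by (simp add: filterlim_at_split filterlim_at_left_to_right)
    then have g0: "((\<lambda>s. g s / s ^ N) \<longlongrightarrow> f0 ^ N) (at_right 0)"
      by (simp add: g_def fneg)
    have "((\<lambda>s. f (- s) / (- s) ^ N) \<longlongrightarrow> 0) at_top"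
      using filterlim_compose[OF finf_lim filterlim_mono[OF filterlim_uminus_at_bot_at_top at_bot_le_at_infinity order_refl]]
      by simp
    then have ginf: "((\<lambda>s. g s / s ^ N) \<longlongrightarrow> 0) at_top"
      by (simp add: g_def fneg)
    obtain w w1 w2 where C2: "C2_on01 w w1 w2"
      and ode: "\<And>t. t \<in> {0<..<1} \<Longrightarrow>
        ((\<lambda>s. (- w1 s) ^ N) has_real_derivative lam ^ N * real N * t ^ (N - 1) * g (w t)) (at t)"
      and bc: "w1 0 = 0" "w 1 = 0" and pos: "\<And>t. t \<in> {0<..<1} \<Longrightarrow> 0 < w t"
      and dec: "\<And>s t. 0 < s \<Longrightarrow> s < t \<Longrightarrow> t < 1 \<Longrightarrow> w1 t < w1 s"
      by (rule positive_solution[OF \<open>N \<ge> 1\<close> gc gpos f0_pos g0 ginf lam]) blast+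
    have "((\<lambda>s. w1 s ^ N) has_real_derivative lam ^ N * real N * t ^ (N - 1) * f (- w t)) (at t)"
      if "t \<in> {0<..<1}" for t
    proof -
      have "((\<lambda>s. (- 1) ^ N * (- w1 s) ^ N) has_real_derivative
          (- 1) ^ N * (lam ^ N * real N * t ^ (N - 1) * g (w t))) (at t)"
        by (intro DERIV_cmult ode that)
      moreover have "(\<lambda>s. (- 1) ^ N * (- w1 s) ^ N) = (\<lambda>s. w1 s ^ N)"
        by (simp flip: power_mult_distrib)
      moreover have "(- 1) ^ N * (lam ^ N * real N * t ^ (N - 1) * g (w t))
          = lam ^ N * real N * t ^ (N - 1) * f (- w t)"
        unfolding g_def by (cases "even N") auto
      ultimately show ?thesis
        by (simp only:)
    qed
    then have "MO_solution N f lam w"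
      unfolding MO_solution_def using C2 bc by blast
    then show ?thesis
      using pos convex[OF C2 dec] unfolding strictly_concave_on_def by blast
  qed
  moreover have "\<exists>um. MO_solution N f lam um \<and> (\<forall>r\<in>{0<..<1}. um r < 0) \<and> strictly_convex_on {0<..<1} um"
  proof -
    have fpos: "0 < f s" if "0 < s" for s
      using f1_sign[rule_format, of s] that by (simp add: zero_less_mult_iff)
    have g0: "((\<lambda>s. f s / s ^ N) \<longlongrightarrow> f0 ^ N) (at_right 0)"
      using f0_lim by (simp add: filterlim_at_split)
    have ginf: "((\<lambda>s. f s / s ^ N) \<longlongrightarrow> 0) at_top"
      by (rule tendsto_mono[OF at_top_le_at_infinity finf_lim])
    obtain w w1 w2 where C2: "C2_on01 w w1 w2"
      and ode: "\<And>t. t \<in> {0<..<1} \<Longrightarrow>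
        ((\<lambda>s. (- w1 s) ^ N) has_real_derivative lam ^ N * real N * t ^ (N - 1) * f (w t)) (at t)"
      and bc: "w1 0 = 0" "w 1 = 0" and pos: "\<And>t. t \<in> {0<..<1} \<Longrightarrow> 0 < w t"
      and dec: "\<And>s t. 0 < s \<Longrightarrow> s < t \<Longrightarrow> t < 1 \<Longrightarrow> w1 t < w1 s"
      by (rule positive_solution[OF \<open>N \<ge> 1\<close> f1_cont fpos f0_pos g0 ginf lam]) blast+
    \<comment> \<open>For \<open>u = - w\<close> the powers \<open>(u')^N\<close> and
      \<open>(- w')^N\<close> agree and \<open>f (- u) = f w\<close>, so the equation carries over
      directly.\<close>
    have "C2_on01 (\<lambda>r. - w r) (\<lambda>r. - w1 r) (\<lambda>r. - w2 r)"
      using C2 unfolding C2_on01_def by (auto intro!: DERIV_minus continuous_intros)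
    then have "MO_solution N f lam (\<lambda>r. - w r)"
      unfolding MO_solution_def using ode bc
      by (intro exI[of _ "\<lambda>r. - w1 r"] exI conjI) auto
    then show ?thesis
      using pos convex[OF C2 dec] by (intro exI[of _ "\<lambda>r. - w r"]) auto
  qed
  ultimately show ?thesis
    by blast
qed

end
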